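(* Let $\mathcal{G}$ be a tree graph with $n$ vertices, let $S\subseteq\{2,\ldots,n\}$ with $s:=|S|$, and suppose that $\mathcal{G}$ can be decomposed into $g$ path graphs glued together at their extremities, with segment lengths $d^i_j$. Assume that $d^i_j\ge4$ for all $j\in\{1,\ldots,s_i+1\}$ and all $i\in\{1,\ldots,g\}$. Let $Y=f^0+\epsilon$ with $f^0\in\mathbb{R}^n$, $\epsilon\sim\mathcal{N}_n(0,\sigma^2I_n)$. Fix $\delta\in(0,1)$, $\gamma>1$, let $\lambda=\gamma\sigma\sqrt{2\log(4(n-s-1)/\delta)/n}$ and $\widehat f:=\arg\min_{f\in\mathbb{R}^n}\{\|Y-f\|_n^2+2\lambda\|Df\|_1\}$. Then, with probability at least $1-\delta$, $$\|\widehat f-f^0\|_n^2\le\inf_{f\in\mathbb{R}^n}\left\{\|f-f^0\|_n^2+4\lambda\|(Df)_{-S}\|_1\right\}+\frac{8\log(2/\delta)\sigma^2}{n}+4\sigma^2\frac{s+1}{n}+8\sigma^2\log(4(n-s-1)/\delta)\left(\frac{2\gamma^2s}{\bar\Delta_h}+5\,\frac{s+g}{n}\log\left(\frac{n}{s+g}\right)\right).$$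
   Context: For $v\in\mathbb{R}^n$, $\|v\|_1=\sum_i|v_i|$ and $\|v\|_n^2=\frac1n\sum_iv_i^2$. The tree has vertices $1,\ldots,n$, is rooted at vertex $1$, and is labelled so that each vertex $i\ge2$ has a parent $\mathrm{pa}(i)<i$ (its neighbour towards the root). The edge between $\mathrm{pa}(i)$ and $i$ is indexed by $i$. $(Df)_i=f_i-f_{\mathrm{pa}(i)}$ for $i=2,\ldots,n$, and $(Df)_{-S}$ is the restriction of $Df$ to indices in $\{2,\ldots,n\}\setminus S$. Decomposition: by removing $g-1$ edges not in $S$, each joining an end vertex of one path to an end vertex of another, the tree is decomposed into $g$ vertex-disjoint path graphs $P^1,\ldots,P^g$ covering all vertices. Let $s_i\ge1$ be the number of edges of $S$ in $P^i$ (so $\sum_is_i=s$). Removing these edges cuts $P^i$ into $s_i+1$ consecutive segments with $d^i_1,\ldots,d^i_{s_i+1}$ vertices, in order along $P^i$. $\Delta^i=(d^i_1,\lceil d^i_2/2\rceil,\lfloor d^i_2/2\rfloor,\ldots,\lceil d^i_{s_i}/2\rceil,\lfloor d^i_{s_i}/2\rfloor,d^i_{s_i+1})\in\mathbb{R}^{2s_i}$, $\Delta=(\Delta^1,\ldots,\Delta^g)\in\mathbb{R}^{2s}$, and $\bar\Delta_h$ is the harmonic mean of $\Delta$. *)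

theory Defs
  imports "HOL-Probability.Probability"
begin

text \<open>
  Vectors of \<open>R^n\<close> are functions extensional on the index set \<open>{1..n}\<close>. The dimension is a
  natural number rather than a type because the vertices of the tree are ordered labels.
\<close>

definition Rn :: "nat \<Rightarrow> (nat \<Rightarrow> real) set" where
  "Rn n = {1..n} \<rightarrow>\<^sub>E UNIV"

definition l1_norm :: "nat set \<Rightarrow> (nat \<Rightarrow> real) \<Rightarrow> real" where
  "l1_norm I v = (\<Sum>i\<in>I. \<bar>v i\<bar>)"

definition sq_norm_n :: "nat \<Rightarrow> (nat \<Rightarrow> real) \<Rightarrow> real" where
  "sq_norm_n n v = (\<Sum>i=1..n. (v i)\<^sup>2) / real n"

definition harmonic_mean :: "real list \<Rightarrow> real" where
  "harmonic_mean xs = real (length xs) / (\<Sum>x\<leftarrow>xs. 1 / x)"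

text \<open>The normal law \<open>N_n(0, \<sigma>^2 I_n)\<close>: the components are independent and \<open>N(0, \<sigma>^2)\<close>.\<close>

definition iso_normal :: "nat \<Rightarrow> real \<Rightarrow> (nat \<Rightarrow> real) measure" where
  "iso_normal n \<sigma> = (\<Pi>\<^sub>M i\<in>{1..n}. density lborel (normal_density 0 \<sigma>))"


text \<open>
  A tree on \<open>{1..n}\<close>, rooted at \<open>1\<close> and labelled such that parents precede their children, is
  given by its parent function; the edges are \<open>{pa i, i}\<close> for \<open>i \<in> {2..n}\<close>. The values of \<open>pa\<close>
  outside \<open>{2..n}\<close> are irrelevant.
\<close>

definition rooted_tree :: "nat \<Rightarrow> (nat \<Rightarrow> nat) \<Rightarrow> bool" where
  "rooted_tree n pa \<longleftrightarrow> 1 \<le> n \<and> (\<forall>i\<in>{2..n}. 1 \<le> pa i \<and> pa i < i)"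

definition tree_edge :: "(nat \<Rightarrow> nat) \<Rightarrow> nat \<Rightarrow> nat set" where
  "tree_edge pa i = {pa i, i}"

definition tree_diff :: "(nat \<Rightarrow> nat) \<Rightarrow> (nat \<Rightarrow> real) \<Rightarrow> nat \<Rightarrow> real" where
  "tree_diff pa f i = f i - f (pa i)"

definition tv_estimator :: "nat \<Rightarrow> (nat \<Rightarrow> nat) \<Rightarrow> real \<Rightarrow> (nat \<Rightarrow> real) \<Rightarrow> (nat \<Rightarrow> real)" where
  "tv_estimator n pa lam y =
     arg_min (\<lambda>f. sq_norm_n n (\<lambda>i. y i - f i) + 2 * lam * l1_norm {2..n} (tree_diff pa f))
       (\<lambda>f. f \<in> Rn n)"


text \<open>
  A path graph is given by the list of its vertices in order along the path (one of the two
  orientations is chosen arbitrarily).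
\<close>

definition path_edges :: "nat list \<Rightarrow> nat set set" where
  "path_edges p = {{p ! k, p ! Suc k} |k. Suc k < length p}"

text \<open>
  \<open>R\<close> is the set of (indices of) removed edges and \<open>ps\<close> the list of the paths
  \<open>P^1, \<dots>, P^g\<close>, where \<open>g = length ps\<close>.
\<close>

definition glued_paths ::
  "nat \<Rightarrow> (nat \<Rightarrow> nat) \<Rightarrow> nat set \<Rightarrow> nat set \<Rightarrow> nat list list \<Rightarrow> bool" where
  "glued_paths n pa S R ps \<longleftrightarrow>
     R \<subseteq> {2..n} - S \<and> card R + 1 = length ps \<and>
     (\<forall>p\<in>set ps. p \<noteq> []) \<and> distinct (concat ps) \<and> set (concat ps) = {1..n} \<and>
     tree_edge pa ` ({2..n} - R) = (\<Union>p\<in>set ps. path_edges p) \<and>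
     (\<forall>r\<in>R. \<exists>i<length ps. \<exists>j<length ps. i \<noteq> j \<and>
        (\<exists>u\<in>{hd (ps ! i), last (ps ! i)}. \<exists>v\<in>{hd (ps ! j), last (ps ! j)}.
           tree_edge pa r = {u, v}))"

definition num_S_edges :: "(nat \<Rightarrow> nat) \<Rightarrow> nat set \<Rightarrow> nat list \<Rightarrow> nat" where
  "num_S_edges pa S p = card {e \<in> S. tree_edge pa e \<in> path_edges p}"

text \<open>Cut a path, given as a list of vertices, at all edges in \<open>C\<close>.\<close>

fun cut_path :: "nat set set \<Rightarrow> nat list \<Rightarrow> nat list list" where
  "cut_path C [] = []"
| "cut_path C [x] = [[x]]"
| "cut_path C (x # y # xs) =
     (let segs = cut_path C (y # xs)
      in if {x, y} \<in> C then [x] # segs else (x # hd segs) # tl segs)"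

definition segment_lengths :: "(nat \<Rightarrow> nat) \<Rightarrow> nat set \<Rightarrow> nat list \<Rightarrow> nat list" where
  "segment_lengths pa S p = map length (cut_path (tree_edge pa ` S) p)"

text \<open>
  From \<open>[d_1, \<dots>, d_{k+1}]\<close> with \<open>k \<ge> 1\<close>: the first and the last length are kept, the inner ones
  are halved.
\<close>

definition path_Delta :: "nat list \<Rightarrow> real list" where
  "path_Delta ds =
     [real (hd ds)]
     @ concat (map (\<lambda>d. [of_int \<lceil>real d / 2\<rceil>, of_int \<lfloor>real d / 2\<rfloor>]) (butlast (tl ds)))
     @ [real (last ds)]"

definition Delta :: "(nat \<Rightarrow> nat) \<Rightarrow> nat set \<Rightarrow> nat list list \<Rightarrow> real list" where
  "Delta pa S ps = concat (map (\<lambda>p. path_Delta (segment_lengths pa S p)) ps)"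

end

theory Submission
  imports Defs
begin

text \<open>
  Let \<open>f\<close> be arbitrary, \<open>h\<close> the difference between the estimator and \<open>f\<close>, and \<open>t = n \<lambda>\<close>. Since the
  objective is a squared distance plus a convex function, its value at \<open>f\<close> exceeds the minimum by
  at least the squared norm of \<open>h\<close> (\<open>tv_estimator_strong_minimality\<close>). Written out and multiplied
  by \<open>n\<close>, the squared error of the estimator plus \<open>\<Sum> h\<^sub>i\<^sup>2\<close> is at most the squared error of \<open>f\<close> plus
  \<open>2 \<langle>\<epsilon>, h\<rangle> + 2 t (\<parallel>Df\<parallel>\<^sub>1 - \<parallel>D(f + h)\<parallel>\<^sub>1)\<close>, and the last bracket is at most
  \<open>2 \<parallel>(Df)\<^bsub>-S\<^esub>\<parallel>\<^sub>1 + \<parallel>(Dh)\<^sub>S\<parallel>\<^sub>1 - \<parallel>(Dh)\<^bsub>-S\<^esub>\<parallel>\<^sub>1\<close>. It remains to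
  pay for the noise and for the jumps of \<open>h\<close> on \<open>S\<close> with \<open>\<Sum> h\<^sub>i\<^sup>2\<close> and with the jumps of \<open>h\<close> off \<open>S\<close>.

  This is done on each segment separately (\<open>segment_bound\<close>), where a segment is a piece of one of the
  paths \<open>P\<^sup>i\<close>. On a segment with \<open>d\<close> vertices the noise splits into its mean, which costs
  \<open>2 (\<Sum> \<epsilon>\<^sub>i)\<^sup>2 / d\<close> and half of \<open>\<Sum> h\<^sub>i\<^sup>2\<close>, and a combination of the jumps of \<open>h\<close> whose \<open>k\<close>-th
  coefficient is the Gaussian bridge of the partial sums, with standard deviation
  \<open>\<sigma> \<phi>\<^sub>k\<close>, \<open>\<phi>\<^sub>k = sqrt (k (d - k) / d)\<close>. If the moduli of these coefficients are at most \<open>\<tau> \<phi>\<^sub>k\<close>, the jumps keep the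
  weights \<open>t - \<tau> \<phi>\<^sub>k\<close>. These equal \<open>t\<close> at the ends of the segment and vary slowly,
  \<open>\<Sum> (\<phi>\<^sub>k - \<phi>\<^bsub>k+1\<^esub>)\<^sup>2 \<le> 2 (1 + ln d)\<close> (\<open>bridge_sd_variation\<close>), so they control \<open>t\<close> times the modulus
  of \<open>h\<close> at an end up to a weighted mean of \<open>h\<close> over the \<open>a\<close> nearest vertices (\<open>endpoint_bound\<close>); its
  cost is \<open>4 t\<^sup>2 / a\<close>, the variation of the weights, and the other half of \<open>\<Sum> h\<^sub>i\<^sup>2\<close>.
  A jump on \<open>S\<close> is at most the sum of the moduli at its two ends. An inner segment serves two edges of
  \<open>S\<close> and is halved; the outer segments of a path serve one edge. The terms \<open>1 / a\<close> therefore add up to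
  \<open>\<Sum> 1 / \<Delta>\<^sub>j\<close>, which is where the harmonic mean comes from.

  The segments are the components left after cutting the edges of \<open>S\<close> and those between the paths.
  Cutting the latter as well makes the segments paths and leaves no noise on these edges, whose jumps
  are dropped. The price is that the means contribute \<open>m = s + g\<close> degrees of freedom rather than
  \<open>s + 1\<close>; as \<open>n \<ge> 4 m\<close>, the surplus fits into the term \<open>m ln (n / m)\<close>
  (\<open>remainder_bound\<close>), which also bounds \<open>\<Sum> ln d\<close> by concavity (\<open>sum_ln_segment_lengths\<close>).

  For the probability, the normalised squared block sums \<open>(\<Sum> \<epsilon>\<^sub>i)\<^sup>2 / (d \<sigma>\<^sup>2)\<close> add up to
  a chi-square variable, whose exponential moment at \<open>1/4\<close> is \<open>2\<^bsup>m/2\<^esup>\<close>. Markov's inequality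
  accounts for \<open>\<delta> / 2\<close>; a union bound over the \<open>n - m \<le> n - s - 1\<close> bridge values accounts for the other \<open>\<delta> / 2\<close>
  (\<open>segment_noise_event\<close>). The event of the theorem is measurable because the
  estimator is a nonexpansive function of the data.
\<close>


section \<open>The total variation estimator as a minimiser\<close>

definition tv_objective :: "nat \<Rightarrow> (nat \<Rightarrow> nat) \<Rightarrow> real \<Rightarrow> (nat \<Rightarrow> real) \<Rightarrow> (nat \<Rightarrow> real) \<Rightarrow> real" where
  "tv_objective n pa lam y f
    = sq_norm_n n (\<lambda>i. y i - f i) + 2 * lam * l1_norm {2..n} (tree_diff pa f)"

lemma sq_norm_n_nonneg: "0 \<le> sq_norm_n n v"
  by (auto simp: sq_norm_n_def intro!: sum_nonneg divide_nonneg_nonneg)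

lemma l1_norm_nonneg: "0 \<le> l1_norm I v"
  by (auto simp: l1_norm_def intro!: sum_nonneg)

lemma square_le_sq_norm_n:
  assumes "i \<in> {1..n}"
  shows "(v i)\<^sup>2 \<le> real n * sq_norm_n n v"
  using assms member_le_sum[of i "{1..n}" "\<lambda>i. (v i)\<^sup>2"] by (simp add: sq_norm_n_def)

text \<open>
  The exact defect of convexity of the squared norm; it is the source of the strong minimality below.
\<close>

lemma sq_norm_n_convex_combination:
  "sq_norm_n n (\<lambda>i. y i - ((1 - \<theta>) * u i + \<theta> * f i))
    = (1 - \<theta>) * sq_norm_n n (\<lambda>i. y i - u i) + \<theta> * sq_norm_n n (\<lambda>i. y i - f i)
      - \<theta> * (1 - \<theta>) * sq_norm_n n (\<lambda>i. f i - u i)"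
proof -
  have "(\<Sum>i=1..n. (y i - ((1 - \<theta>) * u i + \<theta> * f i))\<^sup>2)
    = (\<Sum>i=1..n. (1 - \<theta>) * (y i - u i)\<^sup>2 + \<theta> * (y i - f i)\<^sup>2 - \<theta> * (1 - \<theta>) * (f i - u i)\<^sup>2)"
    by (intro sum.cong) (auto simp: power2_eq_square algebra_simps)
  then show ?thesis
    by (simp add: sq_norm_n_def sum.distrib sum_subtractf sum_distrib_left add_divide_distrib diff_divide_distrib)
qed

lemma l1_tree_diff_convex:
  assumes "0 \<le> \<theta>" "\<theta> \<le> 1"
  shows "l1_norm I (tree_diff pa (\<lambda>i. (1 - \<theta>) * u i + \<theta> * f i))
    \<le> (1 - \<theta>) * l1_norm I (tree_diff pa u) + \<theta> * l1_norm I (tree_diff pa f)"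
  unfolding l1_norm_def sum_distrib_left sum.distrib[symmetric]
proof (rule sum_mono)
  fix i
  have "tree_diff pa (\<lambda>i. (1 - \<theta>) * u i + \<theta> * f i) i
      = (1 - \<theta>) * tree_diff pa u i + \<theta> * tree_diff pa f i"
    by (simp add: tree_diff_def algebra_simps)
  then show "\<bar>tree_diff pa (\<lambda>i. (1 - \<theta>) * u i + \<theta> * f i) i\<bar>
      \<le> (1 - \<theta>) * \<bar>tree_diff pa u i\<bar> + \<theta> * \<bar>tree_diff pa f i\<bar>"
    using abs_triangle_ineq[of "(1 - \<theta>) * tree_diff pa u i" "\<theta> * tree_diff pa f i"] assms
    by (simp add: abs_mult)
qed

text \<open>
  Outside \<open>{1..n}\<close> both functions take the default value, which a convex combination preserves.
\<close>

lemma Rn_convex_combination: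
  assumes "u \<in> Rn n" "f \<in> Rn n"
  shows "(\<lambda>i. (1 - \<theta>) * u i + \<theta> * f i) \<in> Rn n"
  using assms by (auto simp: Rn_def PiE_def extensional_def algebra_simps)

lemma tv_objective_continuous: "continuous_on UNIV (tv_objective n pa lam y)"
  unfolding tv_objective_def[abs_def] sq_norm_n_def l1_norm_def tree_diff_def divide_inverse
  by (intro continuous_intros continuous_on_product_coordinates)

text \<open>
  The box of extensional functions is a full product in which every coordinate outside \<open>{1..n}\<close> ranges
  over the singleton of the default value, so it is compact by Tychonoff's theorem.
\<close>

lemma compact_box: "compact (PiE {1..n::nat} (\<lambda>i. {- B..B::real}))"
proof -
  have "PiE {1..n} (\<lambda>i. {- B..B}) = PiE UNIV (\<lambda>i. if i \<in> {1..n} then {- B..B} else {undefined})"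
    by (auto simp: PiE_def Pi_def extensional_def split: if_splits)
  moreover have "compactin (product_topology (\<lambda>i. euclidean) (UNIV::nat set))
      (PiE UNIV (\<lambda>i. if i \<in> {1..n} then {- B..B} else {undefined::real}))"
    unfolding compactin_PiE by auto
  ultimately show ?thesis by (simp add: euclidean_product_topology)
qed

text \<open>
  Functions that do at least as well as zero lie in a compact box.
\<close>

lemma tv_objective_minimizer:
  assumes n: "0 < n" and lam: "0 \<le> lam"
  shows "\<exists>u\<in>Rn n. \<forall>f\<in>Rn n. tv_objective n pa lam y u \<le> tv_objective n pa lam y f"
proof -
  define z where "z = (\<lambda>i\<in>{1..n}. 0::real)"
  define c where "c = tv_objective n pa lam y z"
  define B where "B = sqrt (real n * c) + (\<Sum>i=1..n. \<bar>y i\<bar>)"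
  have z: "z \<in> Rn n" by (simp add: z_def Rn_def)
  have c: "0 \<le> c" unfolding c_def tv_objective_def using lam
    by (simp add: sq_norm_n_nonneg l1_norm_nonneg)
  have B: "0 \<le> B" unfolding B_def using c by (auto intro!: add_nonneg_nonneg sum_nonneg)
  have small: "f \<in> PiE {1..n} (\<lambda>i. {- B..B})" if f: "f \<in> Rn n" "tv_objective n pa lam y f \<le> c" for f
  proof -
    have "f i \<in> {- B..B}" if i: "i \<in> {1..n}" for i
    proof -
      have "sq_norm_n n (\<lambda>i. y i - f i) \<le> c"
        using f(2) lam l1_norm_nonneg[of "{2..n}" "tree_diff pa f"] unfolding tv_objective_def
        by (smt (verit) mult_nonneg_nonneg)
      then have "(y i - f i)\<^sup>2 \<le> real n * c"
        using square_le_sq_norm_n[OF i, of "\<lambda>i. y i - f i"] by (smt (verit) mult_left_mono of_nat_0_le_iff)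
      then have "\<bar>y i - f i\<bar> \<le> sqrt (real n * c)" by (simp add: real_le_rsqrt)
      moreover have "\<bar>y i\<bar> \<le> (\<Sum>i=1..n. \<bar>y i\<bar>)" using i by (intro member_le_sum) auto
      ultimately show ?thesis unfolding B_def by (auto simp: abs_le_iff)
    qed
    then show ?thesis using f(1) by (auto simp: Rn_def PiE_def)
  qed
  let ?K = "PiE {1..n} (\<lambda>i. {- B..B})"
  have "?K \<noteq> {}" using small[OF z] c_def by auto
  then have "\<exists>u\<in>?K. \<forall>f\<in>?K. tv_objective n pa lam y u \<le> tv_objective n pa lam y f"
    by (rule continuous_attains_inf[OF compact_box])
      (rule continuous_on_subset[OF tv_objective_continuous subset_UNIV])
  then obtain u where u: "u \<in> ?K" "\<And>f. f \<in> ?K \<Longrightarrow> tv_objective n pa lam y u \<le> tv_objective n pa lam y f"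
    by blast
  have "u \<in> Rn n" using u(1) by (auto simp: Rn_def PiE_def)
  moreover have "tv_objective n pa lam y u \<le> tv_objective n pa lam y f" if "f \<in> Rn n" for f
  proof (cases "tv_objective n pa lam y f \<le> c")
    case True then show ?thesis by (intro u(2) small[OF that])
  next
    case False
    moreover have "tv_objective n pa lam y u \<le> c" unfolding c_def using u(2) small[OF z] c_def by auto
    ultimately show ?thesis by simp
  qed
  ultimately show ?thesis by blast
qed

lemma tv_estimator_minimizes:
  assumes "0 < n" "0 \<le> lam"
  shows "tv_estimator n pa lam y \<in> Rn n"
    and "f \<in> Rn n \<Longrightarrow> tv_objective n pa lam y (tv_estimator n pa lam y) \<le> tv_objective n pa lam y f"
proof -
  obtain u where "u \<in> Rn n" "\<And>f. f \<in> Rn n \<Longrightarrow> tv_objective n pa lam y u \<le> tv_objective n pa lam y f"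
    using tv_objective_minimizer[OF assms, of pa y] by blast
  then have "is_arg_min (tv_objective n pa lam y) (\<lambda>f. f \<in> Rn n) u"
    by (auto simp: is_arg_min_def not_less)
  then have "is_arg_min (tv_objective n pa lam y) (\<lambda>f. f \<in> Rn n) (tv_estimator n pa lam y)"
    unfolding tv_estimator_def tv_objective_def[symmetric] arg_min_def by (rule someI[where P = "is_arg_min (tv_objective n pa lam y) (\<lambda>f. f \<in> Rn n)"])
  then show "tv_estimator n pa lam y \<in> Rn n"
    and "f \<in> Rn n \<Longrightarrow> tv_objective n pa lam y (tv_estimator n pa lam y) \<le> tv_objective n pa lam y f"
    by (auto simp: is_arg_min_def not_less)
qed

text \<open>
  Moving from the minimiser \<open>u\<close> a fraction \<open>\<theta>\<close> of the way towards \<open>f\<close> does not decrease the objective,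
  while convexity bounds its change by
  \<open>\<theta>\<close> times the difference of the objectives minus \<open>\<theta> (1 - \<theta>)\<close> times the squared distance.
  Dividing by \<open>\<theta>\<close> and letting \<open>\<theta>\<close> tend to \<open>0\<close> gives the claim.
\<close>

lemma tv_estimator_strong_minimality:
  fixes y f :: "nat \<Rightarrow> real" and pa :: "nat \<Rightarrow> nat"
  assumes n: "0 < n" and lam: "0 \<le> lam" and f: "f \<in> Rn n"
  defines "u \<equiv> tv_estimator n pa lam y"
  shows "tv_objective n pa lam y u + sq_norm_n n (\<lambda>i. f i - u i) \<le> tv_objective n pa lam y f"
proof -
  note u = tv_estimator_minimizes[OF n lam, where pa = pa and y = y, folded u_def]
  have "z * sq_norm_n n (\<lambda>i. f i - u i) \<le> tv_objective n pa lam y f - tv_objective n pa lam y u"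
    if z: "0 < z" "z < 1" for z
  proof -
    define \<theta> where "\<theta> = 1 - z"
    have \<theta>: "0 < \<theta>" "\<theta> \<le> 1" using z by (auto simp: \<theta>_def)
    let ?w = "\<lambda>i. (1 - \<theta>) * u i + \<theta> * f i"
    have "tv_objective n pa lam y u \<le> tv_objective n pa lam y ?w"
      by (rule u(2)[OF Rn_convex_combination[OF u(1) f]])
    also have "\<dots> \<le> (1 - \<theta>) * tv_objective n pa lam y u + \<theta> * tv_objective n pa lam y f
        - \<theta> * (1 - \<theta>) * sq_norm_n n (\<lambda>i. f i - u i)"
      unfolding tv_objective_def sq_norm_n_convex_combination
      using mult_left_mono[OF l1_tree_diff_convex[of \<theta> "{2..n}" pa u f], of "2 * lam"] \<theta> lam
      by (simp add: algebra_simps)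
    finally have "\<theta> * (z * sq_norm_n n (\<lambda>i. f i - u i))
        \<le> \<theta> * (tv_objective n pa lam y f - tv_objective n pa lam y u)"
      by (simp add: \<theta>_def algebra_simps)
    then show ?thesis using \<theta>(1) by (simp only: mult_le_cancel_left_pos)
  qed
  then have "sq_norm_n n (\<lambda>i. f i - u i) \<le> tv_objective n pa lam y f - tv_objective n pa lam y u"
    by (rule field_le_mult_one_interval)
  then show ?thesis by simp
qed

text \<open>
  The estimator is the proximal map of the penalty: add the strong minimality of each of the two
  estimates, compared with the other one.
\<close>

lemma tv_estimator_nonexpansive:
  assumes n: "0 < n" and lam: "0 \<le> lam"
  shows "sq_norm_n n (\<lambda>i. tv_estimator n pa lam y i - tv_estimator n pa lam y' i)
    \<le> sq_norm_n n (\<lambda>i. y i - y' i)"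
proof -
  let ?u = "tv_estimator n pa lam y" and ?u' = "tv_estimator n pa lam y'"
  have mem: "?u \<in> Rn n" "?u' \<in> Rn n" using tv_estimator_minimizes(1)[OF n lam] by auto
  have "sq_norm_n n (\<lambda>i. y i - ?u i) + sq_norm_n n (\<lambda>i. ?u' i - ?u i)
      + (sq_norm_n n (\<lambda>i. y' i - ?u' i) + sq_norm_n n (\<lambda>i. ?u i - ?u' i))
    \<le> sq_norm_n n (\<lambda>i. y i - ?u' i) + sq_norm_n n (\<lambda>i. y' i - ?u i)"
    using tv_estimator_strong_minimality[OF n lam mem(2), where pa = pa and y = y]
      tv_estimator_strong_minimality[OF n lam mem(1), where pa = pa and y = y'] unfolding tv_objective_def by linarith
  moreover have "sq_norm_n n (\<lambda>i. y i - ?u' i) + sq_norm_n n (\<lambda>i. y' i - ?u i)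
      \<le> sq_norm_n n (\<lambda>i. y i - ?u i) + sq_norm_n n (\<lambda>i. y' i - ?u' i)
        + sq_norm_n n (\<lambda>i. y i - y' i) + sq_norm_n n (\<lambda>i. ?u i - ?u' i)"
  proof -
    have "(a - d)\<^sup>2 + (b - c)\<^sup>2 \<le> (a - c)\<^sup>2 + (b - d)\<^sup>2 + (a - b)\<^sup>2 + (c - d)\<^sup>2" for a b c d :: real
      using zero_le_power2[of "a - b - (c - d)"] by (simp add: power2_eq_square algebra_simps)
    then show ?thesis unfolding sq_norm_n_def add_divide_distrib[symmetric] sum.distrib[symmetric]
      by (intro divide_right_mono sum_mono) auto
  qed
  moreover have "sq_norm_n n (\<lambda>i. ?u' i - ?u i) = sq_norm_n n (\<lambda>i. ?u i - ?u' i)"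
    by (simp add: sq_norm_n_def power2_commute)
  ultimately show ?thesis by linarith
qed

lemma tv_estimator_continuous:
  assumes n: "0 < n" and lam: "0 \<le> lam" and i: "i \<in> {1..n}"
  shows "continuous_on UNIV (\<lambda>y. tv_estimator n pa lam y i)"
  unfolding continuous_on
proof
  fix y0 :: "nat \<Rightarrow> real"
  let ?G = "tv_estimator n pa lam"
  have le: "dist (?G y i) (?G y0 i) \<le> sqrt (\<Sum>j=1..n. (y j - y0 j)\<^sup>2)" for y
  proof -
    have "(?G y i - ?G y0 i)\<^sup>2 \<le> real n * sq_norm_n n (\<lambda>i. ?G y i - ?G y0 i)"
      by (rule square_le_sq_norm_n[OF i])
    also have "\<dots> \<le> real n * sq_norm_n n (\<lambda>i. y i - y0 i)"
      by (intro mult_left_mono tv_estimator_nonexpansive n lam) simp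
    also have "\<dots> = (\<Sum>j=1..n. (y j - y0 j)\<^sup>2)" using n by (simp add: sq_norm_n_def)
    finally show ?thesis by (simp add: dist_real_def real_le_rsqrt)
  qed
  have "continuous_on UNIV (\<lambda>y::nat \<Rightarrow> real. sqrt (\<Sum>j=1..n. (y j - y0 j)\<^sup>2))"
    by (intro continuous_intros continuous_on_product_coordinates)
  then have "((\<lambda>y::nat \<Rightarrow> real. sqrt (\<Sum>j=1..n. (y j - y0 j)\<^sup>2)) \<longlongrightarrow> 0) (at y0)"
    unfolding continuous_on by (drule_tac x = y0 in bspec) auto
  then have "((\<lambda>y. dist (?G y i) (?G y0 i)) \<longlongrightarrow> 0) (at y0)"
    by (rule tendsto_sandwich[OF _ _ tendsto_const, rotated 2]) (use le in \<open>auto intro!: always_eventually\<close>)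
  then show "((\<lambda>y. ?G y i) \<longlongrightarrow> ?G y0 i) (at y0)"
    by (subst tendsto_dist_iff)
qed

lemma tv_estimator_measurable:
  assumes "0 < n" "0 \<le> lam" "i \<in> {1..n}"
    and Y: "\<And>j. (\<lambda>\<omega>. Y \<omega> j) \<in> borel_measurable M"
  shows "(\<lambda>\<omega>. tv_estimator n pa lam (Y \<omega>) i) \<in> borel_measurable M"
  using measurable_compose[OF measurable_coordinatewise_then_product[OF Y]
      borel_measurable_continuous_onI[OF tv_estimator_continuous[OF assms(1-3)]]] .

section \<open>Noise and end values on a single segment\<close>

lemma sum_by_parts_differences:
  fixes c x :: "nat \<Rightarrow> real"
  shows "(\<Sum>i<Suc m. c i * x i)
    = (\<Sum>k<m. (\<Sum>i<Suc k. c i) * (x k - x (Suc k))) + (\<Sum>i<Suc m. c i) * x m"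
  by (induction m) (auto simp: algebra_simps)

lemma sum_both_ends_le:
  fixes F :: "nat \<Rightarrow> real"
  assumes "a + b \<le> m" "\<And>k. k < m \<Longrightarrow> 0 \<le> F k"
  shows "(\<Sum>k<a. F k) + (\<Sum>k<b. F (m - Suc k)) \<le> (\<Sum>k<m. F k)"
proof -
  have "(\<Sum>k<b. F (m - Suc k)) = (\<Sum>k=m-b..<m. F k)"
    using assms(1)
    by (intro sum.reindex_bij_witness[of _ "\<lambda>k. m - Suc k" "\<lambda>k. m - Suc k"]) auto
  then have "(\<Sum>k<a. F k) + (\<Sum>k<b. F (m - Suc k)) = sum F ({..<a} \<union> {m-b..<m})"
    using assms(1) by (subst sum.union_disjoint) auto
  also have "\<dots> \<le> (\<Sum>k<m. F k)"
    using assms by (intro sum_mono2) auto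
  finally show ?thesis .
qed

lemma two_mult_le_squares:
  fixes c x :: real
  shows "2 * (c * x) \<le> 2 * c\<^sup>2 + x\<^sup>2 / 2"
  using zero_le_power2[of "2 * c - x"] by (simp add: power2_eq_square algebra_simps)

lemma square_add_le:
  fixes p q :: real
  shows "(p + q)\<^sup>2 \<le> 2 * p\<^sup>2 + 2 * q\<^sup>2"
  using zero_le_power2[of "p - q"] by (simp add: power2_eq_square algebra_simps)

text \<open>
  Multiply the weights \<open>v\<close> by the linear function that is \<open>1\<close> at the end vertex \<open>0\<close> and vanishes
  past vertex \<open>a - 1\<close>, and sum by parts: \<open>t x\<^sub>0\<close> is the sum of the jumps of \<open>x\<close>, with coefficients at
  most \<open>v\<close> in modulus, and of \<open>\<Sum> c\<^sub>i x\<^sub>i\<close>, where \<open>c\<close> consists of the increments of the product. By the product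
  rule the modulus of \<open>c\<^sub>i\<close> is at most an increment of \<open>v\<close> plus \<open>t / a\<close>.
\<close>

lemma endpoint_bound:
  fixes x v :: "nat \<Rightarrow> real"
  assumes a: "0 < a" and v0: "v 0 = t" and v: "\<And>k. k < a \<Longrightarrow> 0 \<le> v k \<and> v k \<le> t"
  shows "2 * t * \<bar>x 0\<bar> \<le> 2 * (\<Sum>k<a-1. v (Suc k) * \<bar>x k - x (Suc k)\<bar>)
    + 4 * (t\<^sup>2 / real a + (\<Sum>k<a-1. (v k - v (Suc k))\<^sup>2)) + (\<Sum>i<a. (x i)\<^sup>2) / 2"
proof -
  obtain b where b: "a = Suc b" using a by (cases a) auto
  \<comment> \<open>The weights, tapered linearly so that they vanish at \<open>a\<close>.\<close>
  define u where "u k = v k * (1 - real k / real a)" for k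
  define c where "c i = u i - u (Suc i)" for i
  have uz: "u a = 0" "u 0 = t" using a v0 by (auto simp: u_def)
  have tel: "(\<Sum>i<Suc k. c i) = t - u (Suc k)" for k
    using uz by (induction k) (auto simp: c_def)
  have id: "t * x 0 = (\<Sum>i<a. c i * x i) + (\<Sum>k<b. u (Suc k) * (x k - x (Suc k)))"
  proof -
    have "(\<Sum>i<a. c i * x i) = (\<Sum>k<b. (t - u (Suc k)) * (x k - x (Suc k))) + t * x b"
      unfolding b sum_by_parts_differences tel using uz by (simp add: b)
    also have "(\<Sum>k<b. (t - u (Suc k)) * (x k - x (Suc k)))
        = t * (\<Sum>k<b. x k - x (Suc k)) - (\<Sum>k<b. u (Suc k) * (x k - x (Suc k)))"
      by (simp only: left_diff_distrib sum_subtractf[of "\<lambda>k. t * (x k - x (Suc k))"] sum_distrib_left)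
    also have "(\<Sum>k<b. x k - x (Suc k)) = x 0 - x b"
      by (rule sum_lessThan_telescope')
    finally show ?thesis by (simp add: algebra_simps)
  qed
  have frac: "0 \<le> 1 - real k / real a" "1 - real k / real a \<le> 1" if "k \<le> a" for k
    using that a by auto
  have "\<bar>\<Sum>k<b. u (Suc k) * (x k - x (Suc k))\<bar> \<le> (\<Sum>k<b. v (Suc k) * \<bar>x k - x (Suc k)\<bar>)"
  proof (rule order_trans[OF sum_abs], rule sum_mono)
    fix k assume "k \<in> {..<b}"
    then have k: "Suc k < a" by (simp add: b)
    have "\<bar>u (Suc k)\<bar> \<le> v (Suc k)"
      unfolding u_def abs_mult using v[OF k] frac[of "Suc k"] k
      by (simp add: mult_left_le del: of_nat_Suc)
    then show "\<bar>u (Suc k) * (x k - x (Suc k))\<bar> \<le> v (Suc k) * \<bar>x k - x (Suc k)\<bar>"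
      unfolding abs_mult by (rule mult_right_mono) simp
  qed
  moreover have "2 * \<bar>\<Sum>i<a. c i * x i\<bar> \<le> 2 * (\<Sum>i<a. (c i)\<^sup>2) + (\<Sum>i<a. (x i)\<^sup>2) / 2"
  proof -
    have "2 * (c i * x i) \<le> 2 * (c i)\<^sup>2 + (x i)\<^sup>2 / 2"
         "2 * (- (c i * x i)) \<le> 2 * (c i)\<^sup>2 + (x i)\<^sup>2 / 2" for i
      using two_mult_le_squares[of "c i" "x i"] two_mult_le_squares[of "- c i" "x i"] by auto
    then have "(\<Sum>i<a. 2 * \<bar>c i * x i\<bar>) \<le> (\<Sum>i<a. 2 * (c i)\<^sup>2 + (x i)\<^sup>2 / 2)"
      by (intro sum_mono) (simp add: abs_if)
    moreover have "2 * \<bar>\<Sum>i<a. c i * x i\<bar> \<le> (\<Sum>i<a. 2 * \<bar>c i * x i\<bar>)"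
      unfolding sum_distrib_left[symmetric] using sum_abs[of "\<lambda>i. c i * x i" "{..<a}"] by simp
    ultimately show ?thesis
      by (simp add: sum.distrib sum_distrib_left sum_divide_distrib)
  qed
  moreover have "(\<Sum>i<a. (c i)\<^sup>2) \<le> 2 * (t\<^sup>2 / real a + (\<Sum>k<b. (v k - v (Suc k))\<^sup>2))"
  proof -
    have ci: "c i = (v i - v (Suc i)) * (1 - real (Suc i) / real a) + v i / real a" for i
      by (simp add: c_def u_def algebra_simps add_divide_distrib)
    have last: "(v i / real a)\<^sup>2 \<le> t\<^sup>2 / (real a)\<^sup>2" if "i < a" for i
      using v[OF that] by (simp add: power_divide divide_right_mono power_mono)
    have bd: "(c i)\<^sup>2 \<le> 2 * (v i - v (Suc i))\<^sup>2 + 2 * (t\<^sup>2 / (real a)\<^sup>2)" if "i < b" for i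
    proof -
      have f: "0 \<le> 1 - real (Suc i) / real a" "1 - real (Suc i) / real a \<le> 1"
        using frac[of "Suc i"] that b by auto
      have "(c i)\<^sup>2 \<le> 2 * ((v i - v (Suc i)) * (1 - real (Suc i) / real a))\<^sup>2 + 2 * (v i / real a)\<^sup>2"
        unfolding ci by (rule square_add_le)
      also have "((v i - v (Suc i)) * (1 - real (Suc i) / real a))\<^sup>2 \<le> (v i - v (Suc i))\<^sup>2"
        unfolding power_mult_distrib using f by (intro mult_left_le power_le_one) auto
      finally show ?thesis using last[of i] that b by simp
    qed
    have "(c b)\<^sup>2 \<le> 2 * (t\<^sup>2 / (real a)\<^sup>2)"
    proof -
      have "real (Suc b) / real a = 1" using b by simp
      then have "c b = v b / real a" by (simp add: ci[of b] del: of_nat_Suc)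
      then have "(c b)\<^sup>2 \<le> t\<^sup>2 / (real a)\<^sup>2" using last[of b] b by simp
      then show ?thesis using zero_le_power2[of "t / real a"] unfolding power_divide by linarith
    qed
    moreover have "(\<Sum>i<b. (c i)\<^sup>2) \<le> (\<Sum>i<b. 2 * (v i - v (Suc i))\<^sup>2 + 2 * (t\<^sup>2 / (real a)\<^sup>2))"
      by (intro sum_mono bd) simp
    moreover have "2 * (\<Sum>i<b. (v i - v (Suc i))\<^sup>2) + real a * (2 * (t\<^sup>2 / (real a)\<^sup>2))
        = 2 * (t\<^sup>2 / real a + (\<Sum>k<b. (v k - v (Suc k))\<^sup>2))"
      using a by (simp add: power2_eq_square)
    moreover have "(\<Sum>i<a. (c i)\<^sup>2) = (\<Sum>i<b. (c i)\<^sup>2) + (c b)\<^sup>2" unfolding b by simp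
    moreover have "real a * (2 * (t\<^sup>2 / (real a)\<^sup>2)) = real b * (2 * (t\<^sup>2 / (real a)\<^sup>2)) + 2 * (t\<^sup>2 / (real a)\<^sup>2)"
      unfolding b of_nat_Suc distrib_right by simp
    ultimately show ?thesis
      by (simp add: sum.distrib sum_distrib_left)
  qed
  moreover have "2 * t * \<bar>x 0\<bar> \<le> 2 * \<bar>\<Sum>i<a. c i * x i\<bar>
      + 2 * \<bar>\<Sum>k<b. u (Suc k) * (x k - x (Suc k))\<bar>"
  proof -
    have "2 * t * \<bar>x 0\<bar> \<le> 2 * \<bar>t * x 0\<bar>" by (simp add: abs_mult mult_right_mono)
    then show ?thesis unfolding id using abs_triangle_ineq by (smt (verit))
  qed
  moreover have "a - 1 = b" by (simp add: b)
  ultimately show ?thesis by (simp only:)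
qed

lemma sqrt_step_le:
  fixes y :: real
  assumes "1 \<le> y"
  shows "(sqrt y - sqrt (y - 1))\<^sup>2 \<le> 1 / y"
proof -
  have "(sqrt y - sqrt (y - 1)) * sqrt y \<le> 1"
  proof -
    have "sqrt (y - 1) * sqrt (y - 1) \<le> sqrt (y - 1) * sqrt y"
      using assms by (intro mult_left_mono) auto
    then show ?thesis using assms by (simp add: algebra_simps)
  qed
  then have "((sqrt y - sqrt (y - 1)) * sqrt y)\<^sup>2 \<le> 1"
    using assms by (intro power_le_one) auto
  then have "(sqrt y - sqrt (y - 1))\<^sup>2 * y \<le> 1" using assms by (simp only: power_mult_distrib real_sqrt_pow2)
  then show ?thesis using assms by (simp add: pos_le_divide_eq)
qed

text \<open>
  The standard deviation at time \<open>k\<close> of the partial sums of \<open>d\<close> independent standard normal variables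
  after subtracting their mean: a discrete Brownian bridge.
\<close>

definition bridge_sd :: "nat \<Rightarrow> nat \<Rightarrow> real" where
  "bridge_sd d k = sqrt (real k * real (d - k) / real d)"

lemma bridge_sd_0 [simp]: "bridge_sd d 0 = 0"
  by (simp add: bridge_sd_def)

lemma bridge_sd_nonneg: "0 \<le> bridge_sd d k"
  by (simp add: bridge_sd_def)

lemma bridge_sd_le: "bridge_sd d k \<le> sqrt (real d)"
proof (cases "k \<le> d \<and> 0 < d")
  case True
  then have "real k * real (d - k) \<le> real d * real d" by (intro mult_mono) auto
  then show ?thesis using True unfolding bridge_sd_def by (simp add: field_simps)
qed (auto simp: bridge_sd_def)

lemma bridge_sd_sym: "k \<le> d \<Longrightarrow> bridge_sd d (d - k) = bridge_sd d k"
  by (simp add: bridge_sd_def mult.commute)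

text \<open>
  Up to the factor \<open>sqrt d\<close>, the standard deviation is the product of \<open>sqrt k\<close> and \<open>sqrt (d - k)\<close>. An
  increment of the product has two parts, one for each factor, of opposite signs; hence its square is
  at most the sum of the squares of the parts, and \<open>sqrt_step_le\<close> applies to each.
\<close>

lemma bridge_sd_step:
  assumes "k < d"
  shows "(bridge_sd d k - bridge_sd d (Suc k))\<^sup>2 \<le> 1 / real (Suc k) + 1 / real (d - k)"
proof -
  define A where "A = sqrt (real (Suc k)) - sqrt (real k)"
  define B where "B = sqrt (real (d - k)) - sqrt (real (d - Suc k))"
  define p where "p = sqrt (real k) * B"
  define q where "q = A * sqrt (real (d - Suc k))"
  have AB: "0 \<le> A" "0 \<le> B" using assms by (auto simp: A_def B_def)
  have A: "A\<^sup>2 \<le> 1 / real (Suc k)" using sqrt_step_le[of "real (Suc k)"] by (simp add: A_def)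
  have B: "B\<^sup>2 \<le> 1 / real (d - k)"
    using sqrt_step_le[of "real (d - k)"] assms by (simp add: B_def of_nat_diff diff_diff_eq add.commute)
  have d: "0 < real d" using assms by simp
  have "bridge_sd d k - bridge_sd d (Suc k) = (p - q) / sqrt (real d)"
    by (simp only: bridge_sd_def p_def q_def A_def B_def real_sqrt_mult real_sqrt_divide
        left_diff_distrib right_diff_distrib diff_divide_distrib)
  then have "(bridge_sd d k - bridge_sd d (Suc k))\<^sup>2 = (p - q)\<^sup>2 / real d"
    by (simp add: power_divide)
  also have "\<dots> \<le> (p\<^sup>2 + q\<^sup>2) / real d"
  proof (rule divide_right_mono)
    have "0 \<le> p * q" using AB by (simp add: p_def q_def)
    then show "(p - q)\<^sup>2 \<le> p\<^sup>2 + q\<^sup>2" by (simp add: power2_eq_square algebra_simps)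
  qed simp
  also have "\<dots> \<le> B\<^sup>2 + A\<^sup>2"
  proof -
    have "p\<^sup>2 = real k * B\<^sup>2" "q\<^sup>2 = real (d - Suc k) * A\<^sup>2"
      by (auto simp: p_def q_def power_mult_distrib)
    moreover have "real k * B\<^sup>2 \<le> real d * B\<^sup>2" "real (d - Suc k) * A\<^sup>2 \<le> real d * A\<^sup>2"
      using assms by (auto intro!: mult_right_mono)
    ultimately show ?thesis using d by (simp add: field_simps)
  qed
  finally show ?thesis using A B by simp
qed

lemma sum_inverse_le_ln:
  assumes "0 < d"
  shows "(\<Sum>k<d. 1 / real (Suc k)) \<le> 1 + ln (real d)"
  using assms
proof (induction d rule: nat_induct_non_zero)
  case 1 then show ?case by simp
next
  case (Suc d)
  have "ln (real d / real (Suc d)) \<le> real d / real (Suc d) - 1"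
    using Suc.hyps by (intro ln_le_minus_one) auto
  also have "\<dots> = - 1 / real (Suc d)" by (simp add: field_simps)
  finally have "ln (real d) + 1 / real (Suc d) \<le> ln (real (Suc d))"
    using Suc.hyps by (subst (asm) ln_div) auto
  then show ?case using Suc.IH by simp
qed

text \<open>
  The two sums run along the two blocks of a segment, each counted from its own end. By the symmetry
  of the bridge they concern disjoint sets of edges of the segment, so that \<open>bridge_sd_step\<close> is
  summed once over the whole segment.
\<close>

lemma bridge_sd_variation:
  assumes "0 < d" "a + b = d"
  shows "(\<Sum>k<a-1. (bridge_sd d k - bridge_sd d (Suc k))\<^sup>2)
       + (\<Sum>k<b-1. (bridge_sd d k - bridge_sd d (Suc k))\<^sup>2) \<le> 2 * (1 + ln (real d))"
proof -
  define g where "g k = 1 / real (Suc k) + 1 / real (d - k)" for k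
  have g0: "0 \<le> g k" for k by (simp add: g_def)
  have sym: "g (d - Suc k) = g k" if "k < d" for k
    using that by (simp add: g_def Suc_diff_Suc algebra_simps)
  have "(\<Sum>k<a-1. (bridge_sd d k - bridge_sd d (Suc k))\<^sup>2) \<le> (\<Sum>k<a-1. g k)"
    using assms unfolding g_def by (intro sum_mono bridge_sd_step) auto
  moreover have "(\<Sum>k<b-1. (bridge_sd d k - bridge_sd d (Suc k))\<^sup>2) \<le> (\<Sum>k<b-1. g (d - Suc k))"
  proof (rule sum_mono)
    fix k assume "k \<in> {..<b-1}"
    then have "k < d" using assms by auto
    then show "(bridge_sd d k - bridge_sd d (Suc k))\<^sup>2 \<le> g (d - Suc k)"
      unfolding sym[OF \<open>k < d\<close>] unfolding g_def by (rule bridge_sd_step)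
  qed
  moreover have "(\<Sum>k<a-1. g k) + (\<Sum>k<b-1. g (d - Suc k)) \<le> (\<Sum>k<d. g k)"
    using assms g0 by (intro sum_both_ends_le) auto
  moreover have "(\<Sum>k<d. g k) = 2 * (\<Sum>k<d. 1 / real (Suc k))"
  proof -
    have "(\<Sum>k<d. 1 / real (d - k)) = (\<Sum>k<d. 1 / real (Suc k))"
      by (rule sum.reindex_bij_witness[of _ "\<lambda>k. d - Suc k" "\<lambda>k. d - Suc k"]) (auto simp: Suc_diff_Suc)
    then show ?thesis unfolding g_def sum.distrib by simp
  qed
  ultimately show ?thesis using sum_inverse_le_ln[OF assms(1)] unfolding distrib_left by linarith
qed

definition bridge :: "nat \<Rightarrow> (nat \<Rightarrow> real) \<Rightarrow> nat \<Rightarrow> real" where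
  "bridge d e k = (\<Sum>i<k. e i) - real k / real d * (\<Sum>i<d. e i)"

lemma noise_decomposition:
  assumes "0 < d"
  shows "(\<Sum>i<d. e i * x i) = (\<Sum>i<d. e i) * (\<Sum>i<d. x i) / real d
    + (\<Sum>k<d-1. bridge d e (Suc k) * (x k - x (Suc k)))"
proof -
  define c where "c i = e i - (\<Sum>i<d. e i) / real d" for i
  obtain m where m: "d = Suc m" using assms by (cases d) auto
  have c: "(\<Sum>i<k. c i) = bridge d e k" for k
    by (simp add: c_def bridge_def sum_subtractf)
  have "bridge d e d = 0" using assms by (simp add: bridge_def)
  then have "(\<Sum>i<d. c i * x i) = (\<Sum>k<d-1. bridge d e (Suc k) * (x k - x (Suc k)))"
    using sum_by_parts_differences[of c x m] unfolding c m by simp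
  moreover have "(\<Sum>i<d. c i * x i) = (\<Sum>i<d. e i * x i) - (\<Sum>i<d. e i) * (\<Sum>i<d. x i) / real d"
    by (simp add: c_def left_diff_distrib sum_subtractf flip: sum_distrib_left sum_divide_distrib)
  ultimately show ?thesis by simp
qed

text \<open>
  The key estimate on one segment, whose vertices are shared between its left end (the first \<open>a\<close>) and
  its right end (the last \<open>b\<close>). An end without vertices has no edge of \<open>S\<close> attached to it: its value is
  not counted on the left-hand side, and \<open>1 / 0 = 0\<close> removes it on the right-hand side.
\<close>

lemma segment_bound:
  fixes e x :: "nat \<Rightarrow> real"
  assumes d: "0 < d" and ab: "a + b = d" and \<tau>: "0 \<le> \<tau>" "\<tau> * sqrt (real d) \<le> t"
    and noise: "\<And>k. 0 < k \<Longrightarrow> k < d \<Longrightarrow> \<bar>bridge d e k\<bar> \<le> \<tau> * bridge_sd d k"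
  shows "2 * (\<Sum>i<d. e i * x i)
      + 2 * t * ((if a = 0 then 0 else \<bar>x 0\<bar>) + (if b = 0 then 0 else \<bar>x (d - 1)\<bar>))
    \<le> 2 * t * (\<Sum>k<d-1. \<bar>x k - x (Suc k)\<bar>) + (\<Sum>i<d. (x i)\<^sup>2) + 2 * ((\<Sum>i<d. e i)\<^sup>2 / real d)
      + 8 * \<tau>\<^sup>2 * (1 + ln (real d)) + 4 * t\<^sup>2 * (1 / real a + 1 / real b)"
proof -
  define v where "v k = t - \<tau> * bridge_sd d k" for k
  have v: "0 \<le> v k \<and> v k \<le> t" for k
    using mult_left_mono[OF bridge_sd_le[of d k] \<tau>(1)] \<tau> bridge_sd_nonneg[of d k]
    by (auto simp: v_def)
  have v0: "v 0 = t" by (simp add: v_def)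
  define x' where "x' k = x (d - Suc k)" for k
  define F where "F k = v (Suc k) * \<bar>x k - x (Suc k)\<bar>" for k
  define V where "V m = (\<Sum>k<m-1. (v k - v (Suc k))\<^sup>2)" for m
  have left: "2 * t * (if a = 0 then 0 else \<bar>x 0\<bar>)
      \<le> 2 * (\<Sum>k<a-1. F k) + 4 * (t\<^sup>2 / real a + V a) + (\<Sum>i<a. (x i)\<^sup>2) / 2"
    using endpoint_bound[of a v t x] v v0 unfolding F_def V_def by (cases "a = 0") auto
  \<comment> \<open>The right end is the left end of the reversed segment, and the weights are symmetric.\<close>
  have right: "2 * t * (if b = 0 then 0 else \<bar>x (d - 1)\<bar>)
      \<le> 2 * (\<Sum>k<b-1. F (d - 1 - Suc k)) + 4 * (t\<^sup>2 / real b + V b) + (\<Sum>i<b. (x (d - Suc i))\<^sup>2) / 2"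
  proof (cases "b = 0")
    case False
    have "(\<Sum>k<b-1. v (Suc k) * \<bar>x' k - x' (Suc k)\<bar>) = (\<Sum>k<b-1. F (d - 1 - Suc k))"
    proof (rule sum.cong)
      fix k assume "k \<in> {..<b-1}"
      then have k: "Suc (Suc k) \<le> d" using ab by auto
      then have "v (d - Suc k) = v (Suc k)" by (simp add: v_def bridge_sd_sym)
      moreover have "Suc (d - 1 - Suc k) = d - Suc k" using k by simp
      ultimately show "v (Suc k) * \<bar>x' k - x' (Suc k)\<bar> = F (d - 1 - Suc k)"
        by (simp add: F_def x'_def abs_minus_commute)
    qed simp
    then show ?thesis
      using False endpoint_bound[of b v t x'] v v0 unfolding V_def by (auto simp: x'_def)
  qed (simp add: V_def)
  have edges: "(\<Sum>k<a-1. F k) + (\<Sum>k<b-1. F (d - 1 - Suc k)) \<le> (\<Sum>k<d-1. F k)"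
    using ab v by (intro sum_both_ends_le) (auto simp: F_def)
  have verts: "(\<Sum>i<a. (x i)\<^sup>2) + (\<Sum>i<b. (x (d - Suc i))\<^sup>2) \<le> (\<Sum>i<d. (x i)\<^sup>2)"
    using ab by (intro sum_both_ends_le) auto
  have "V m = \<tau>\<^sup>2 * (\<Sum>k<m-1. (bridge_sd d k - bridge_sd d (Suc k))\<^sup>2)" for m
    unfolding V_def v_def sum_distrib_left
    by (intro sum.cong) (auto simp: power2_eq_square algebra_simps)
  then have "V a + V b \<le> \<tau>\<^sup>2 * (2 * (1 + ln (real d)))"
    unfolding distrib_left[symmetric] using bridge_sd_variation[OF d ab]
    by (simp add: mult_left_mono del: distrib_left_numeral flip: distrib_left)
  moreover have "2 * (\<Sum>i<d. e i * x i) \<le> 2 * ((\<Sum>i<d. e i)\<^sup>2 / real d) + (\<Sum>i<d. (x i)\<^sup>2) / 2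
      + 2 * (t * (\<Sum>k<d-1. \<bar>x k - x (Suc k)\<bar>) - (\<Sum>k<d-1. F k))"
  proof -
    have "2 * ((\<Sum>i<d. e i) * (\<Sum>i<d. x i)) \<le> 2 * (\<Sum>i<d. e i)\<^sup>2 + (\<Sum>i<d. x i)\<^sup>2 / 2"
      by (rule two_mult_le_squares)
    moreover have "(\<Sum>i<d. x i)\<^sup>2 \<le> real d * (\<Sum>i<d. (x i)\<^sup>2)"
      using Cauchy_Schwarz_ineq_sum[of "\<lambda>_. 1" x "{..<d}"] by simp
    ultimately have "2 * ((\<Sum>i<d. e i) * (\<Sum>i<d. x i)) \<le> 2 * (\<Sum>i<d. e i)\<^sup>2 + real d * (\<Sum>i<d. (x i)\<^sup>2) / 2"
      by simp
    then have "2 * ((\<Sum>i<d. e i) * (\<Sum>i<d. x i)) / real d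
        \<le> (2 * (\<Sum>i<d. e i)\<^sup>2 + real d * (\<Sum>i<d. (x i)\<^sup>2) / 2) / real d"
      by (rule divide_right_mono) simp
    then have 1: "2 * ((\<Sum>i<d. e i) * (\<Sum>i<d. x i) / real d)
        \<le> 2 * ((\<Sum>i<d. e i)\<^sup>2 / real d) + (\<Sum>i<d. (x i)\<^sup>2) / 2"
      using d by (simp add: add_divide_distrib)
    have "(\<Sum>k<d-1. bridge d e (Suc k) * (x k - x (Suc k)))
        \<le> (\<Sum>k<d-1. t * \<bar>x k - x (Suc k)\<bar> - F k)"
    proof (rule sum_mono)
      fix k assume "k \<in> {..<d-1}"
      then have "\<bar>bridge d e (Suc k)\<bar> \<le> t - v (Suc k)"
        using noise[of "Suc k"] by (auto simp: v_def)
      then have "\<bar>bridge d e (Suc k)\<bar> * \<bar>x k - x (Suc k)\<bar> \<le> (t - v (Suc k)) * \<bar>x k - x (Suc k)\<bar>"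
        by (rule mult_right_mono) simp
      then show "bridge d e (Suc k) * (x k - x (Suc k)) \<le> t * \<bar>x k - x (Suc k)\<bar> - F k"
        unfolding F_def left_diff_distrib abs_mult[symmetric] by linarith
    qed
    then show ?thesis using 1 unfolding noise_decomposition[OF d, of e x]
      by (simp add: sum_subtractf flip: sum_distrib_left)
  qed
  ultimately show ?thesis using left right edges verts
    by (simp add: distrib_left)
qed

section \<open>Cutting the tree into segments\<close>

text \<open>
  Edges as lists along a path allow sums over edges to be computed by recursion along \<open>cut_path\<close>;
  \<open>cut_edges\<close> are the edges between consecutive pieces.
\<close>

fun edge_list :: "'a list \<Rightarrow> 'a set list" where
  "edge_list (x # y # p) = {x, y} # edge_list (y # p)"
| "edge_list _ = []"

fun cut_edges :: "'a list list \<Rightarrow> 'a set list" where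
  "cut_edges (s # s' # segs) = {last s, hd s'} # cut_edges (s' # segs)"
| "cut_edges _ = []"

lemma edge_list_conv_nth: "edge_list p = map (\<lambda>k. {p ! k, p ! Suc k}) [0..<length p - 1]"
proof (induction p rule: edge_list.induct)
  case (1 x y p)
  have "[0..<length (x # y # p) - 1] = 0 # map Suc [0..<length (y # p) - 1]"
    by (simp add: map_Suc_upt upt_conv_Cons del: upt_Suc)
  then show ?case using 1 by (simp add: comp_def del: upt_Suc)
qed auto

lemma set_edge_list: "set (edge_list p) = path_edges p"
  by (auto simp: edge_list_conv_nth path_edges_def)

lemma edge_list_subset: "e \<in> set (edge_list p) \<Longrightarrow> e \<noteq> {} \<and> e \<subseteq> set p"
  by (auto simp: edge_list_conv_nth)

lemma distinct_edge_list: "distinct p \<Longrightarrow> distinct (edge_list p)"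
proof (induction p rule: edge_list.induct)
  case (1 x y p)
  then show ?case using edge_list_subset[of "{x, y}" "y # p"] by auto
qed auto

lemma distinct_concat_edge_list:
  "distinct (concat ps) \<Longrightarrow> distinct (concat (map edge_list ps))"
proof (induction ps)
  case (Cons p ps)
  have "set (edge_list p) \<inter> set (concat (map edge_list ps)) = {}"
  proof (rule ccontr)
    assume "set (edge_list p) \<inter> set (concat (map edge_list ps)) \<noteq> {}"
    then obtain e q where e: "e \<in> set (edge_list p)" "q \<in> set ps" "e \<in> set (edge_list q)"
      by auto
    then have "e \<noteq> {}" "e \<subseteq> set p \<inter> set q" using edge_list_subset by fastforce+
    then show False using Cons.prems e(2) by auto
  qed
  then show ?case using Cons by (auto simp: distinct_edge_list)
qed simp

lemma cut_path_nonempty: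
  "p \<noteq> [] \<Longrightarrow> cut_path C p \<noteq> [] \<and> hd (hd (cut_path C p)) = hd p"
  by (cases "(C, p)" rule: cut_path.cases) (auto simp: Let_def)

lemma cut_path_segments_nonempty: "[] \<notin> set (cut_path C p)"
proof (induction C p rule: cut_path.induct)
  case (3 C x y p)
  then show ?case by (cases "cut_path C (y # p)") (auto simp: Let_def)
qed auto

lemma concat_cut_path: "concat (cut_path C p) = p"
proof (induction C p rule: cut_path.induct)
  case (3 C x y p)
  then show ?case using cut_path_nonempty[of "y # p" C]
    by (cases "cut_path C (y # p)") (auto simp: Let_def)
qed auto

lemma cut_edges_Cons_hd:
  "s \<noteq> [] \<Longrightarrow> cut_edges ((x # s) # segs) = cut_edges (s # segs)"
  by (cases segs) auto

lemma filter_in_edge_list: "filter (\<lambda>e. e \<in> C) (edge_list p) = cut_edges (cut_path C p)"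
proof (induction C p rule: cut_path.induct)
  case (3 C x y p)
  obtain s segs where s: "cut_path C (y # p) = s # segs"
    using cut_path_nonempty[of "y # p" C] by (cases "cut_path C (y # p)") auto
  have "s \<noteq> []" "hd s = y"
    using s cut_path_nonempty[of "y # p" C] cut_path_segments_nonempty[of C "y # p"] by auto
  then show ?case using 3 s by (auto simp: cut_edges_Cons_hd)
qed auto

lemma filter_notin_edge_list:
  "filter (\<lambda>e. e \<notin> C) (edge_list p) = concat (map edge_list (cut_path C p))"
proof (induction C p rule: cut_path.induct)
  case (3 C x y p)
  obtain s segs where s: "cut_path C (y # p) = s # segs"
    using cut_path_nonempty[of "y # p" C] by (cases "cut_path C (y # p)") auto
  have "s \<noteq> []" "hd s = y"
    using s cut_path_nonempty[of "y # p" C] cut_path_segments_nonempty[of C "y # p"] by auto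
  then show ?case using 3 s by (cases s) auto
qed auto

lemma length_cut_edges: "length (cut_edges segs) = length segs - 1"
  by (induction segs rule: cut_edges.induct) auto

lemma length_path_Delta:
  "2 \<le> length ds \<Longrightarrow> length (path_Delta ds) = 2 * (length ds - 1)"
  by (simp add: path_Delta_def length_concat comp_def sum_list_triv)

text \<open>
  A function of the unordered edge, so that the orientation of a path and the direction towards the
  root of the tree need not agree.
\<close>

definition edge_jump :: "('a \<Rightarrow> real) \<Rightarrow> 'a set \<Rightarrow> real" where
  "edge_jump h e = Max (h ` e) - Min (h ` e)"

lemma edge_jump_pair: "edge_jump h {u, v} = \<bar>h u - h v\<bar>"
  by (simp add: edge_jump_def max_def min_def)

text \<open>
  The combinatorics of one path. \<open>\<alpha>\<close> and \<open>\<beta>\<close> are the costs at the first and the last vertex of a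
  segment, and \<open>Q\<close> is what remains to be balanced on it. The first segment only pays at its last vertex,
  the final one only at its first vertex, and the inner ones at both.
\<close>

lemma path_bound_from_segment_bounds:
  fixes Q \<alpha> \<beta> :: "'a list \<Rightarrow> real"
  assumes T: "0 \<le> T"
    and first: "\<And>s. s \<in> set segs \<Longrightarrow> Q s + T * \<beta> s \<le> c * (1 / real (length s))"
    and final: "\<And>s. s \<in> set segs \<Longrightarrow> Q s + T * \<alpha> s \<le> c * (1 / real (length s))"
    and inner: "\<And>s. s \<in> set segs \<Longrightarrow> Q s + T * (\<alpha> s + \<beta> s)
      \<le> c * (1 / of_int \<lceil>real (length s) / 2\<rceil> + 1 / of_int \<lfloor>real (length s) / 2\<rfloor>)"
    and jump: "\<And>s s'. F {last s, hd s'} \<le> \<beta> s + \<alpha> s'"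
    and len: "2 \<le> length segs"
  shows "(\<Sum>s\<leftarrow>segs. Q s) + T * (\<Sum>e\<leftarrow>cut_edges segs. F e)
    \<le> c * (\<Sum>x\<leftarrow>path_Delta (map length segs). 1 / x)"
proof -
  define D where "D ds = (\<Sum>x\<leftarrow>concat (map (\<lambda>d. [of_int \<lceil>real d / 2\<rceil>, of_int \<lfloor>real d / 2\<rfloor>]) ds). (1::real) / x)"
    for ds :: "nat list"
  have D: "D [] = 0" "D (d # ds) = 1 / of_int \<lceil>real d / 2\<rceil> + 1 / of_int \<lfloor>real d / 2\<rfloor> + D ds" for d ds
    by (simp_all add: D_def)
  \<comment> \<open>A run of segments that excludes the first one, entered through the edge of \<open>S\<close> before it.\<close>
  have tail: "(\<Sum>s\<leftarrow>ss. Q s) + T * (\<alpha> (hd ss) + (\<Sum>e\<leftarrow>cut_edges ss. F e))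
      \<le> c * (D (butlast (map length ss)) + 1 / real (length (last ss)))"
    if "ss \<noteq> []" "set ss \<subseteq> set segs" for ss
    using that
  proof (induction ss rule: cut_edges.induct)
    case (1 s s' ss)
    have "Q s + T * (\<alpha> s + \<beta> s) \<le> c * (1 / of_int \<lceil>real (length s) / 2\<rceil> + 1 / of_int \<lfloor>real (length s) / 2\<rfloor>)"
      using 1 by (intro inner) auto
    moreover have "T * F {last s, hd s'} \<le> T * (\<beta> s + \<alpha> s')"
      using jump T by (rule mult_left_mono)
    moreover have "(\<Sum>s\<leftarrow>s' # ss. Q s) + T * (\<alpha> (hd (s' # ss)) + (\<Sum>e\<leftarrow>cut_edges (s' # ss). F e))
        \<le> c * (D (butlast (map length (s' # ss))) + 1 / real (length (last (s' # ss))))"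
      using 1 by auto
    moreover have "butlast (map length (s # s' # ss)) = length s # butlast (map length (s' # ss))"
      by simp
    ultimately show ?case by (simp add: D distrib_left)
  next
    case ("2_2" s)
    then show ?case using final[of s] by (simp add: D)
  qed simp
  obtain s ss where segs: "segs = s # ss" "ss \<noteq> []" using len by (cases segs; cases "tl segs") auto
  have cut: "cut_edges segs = {last s, hd (hd ss)} # cut_edges ss"
    using segs by (cases ss) auto
  have "Q s + T * \<beta> s \<le> c * (1 / real (length s))" by (intro first) (simp add: segs)
  moreover have "T * F {last s, hd (hd ss)} \<le> T * (\<beta> s + \<alpha> (hd ss))"
    using jump T by (rule mult_left_mono)
  moreover have "(\<Sum>x\<leftarrow>path_Delta (map length segs). 1 / x)
      = 1 / real (length s) + (D (butlast (map length ss)) + 1 / real (length (last ss)))"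
    using segs by (simp add: path_Delta_def D_def last_map)
  moreover have "(\<Sum>s\<leftarrow>ss. Q s) + T * (\<alpha> (hd ss) + (\<Sum>e\<leftarrow>cut_edges ss. F e))
      \<le> c * (D (butlast (map length ss)) + 1 / real (length (last ss)))"
    using segs by (intro tail) auto
  moreover have "(\<Sum>s\<leftarrow>segs. Q s) = Q s + (\<Sum>s\<leftarrow>ss. Q s)" by (simp add: segs)
  ultimately show ?thesis by (simp add: cut distrib_left)
qed

lemma sum_list_edge_list:
  "(\<Sum>e\<leftarrow>edge_list p. edge_jump h e) = (\<Sum>k<length p - 1. \<bar>h (p ! k) - h (p ! Suc k)\<bar>)"
  by (simp add: edge_list_conv_nth comp_def edge_jump_pair interv_sum_list_conv_sum_set_nat
      atLeast0LessThan del: upt_Suc)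

lemma sum_list_nth_lessThan: "(\<Sum>x\<leftarrow>xs. f x) = (\<Sum>i<length xs. f (xs ! i))"
  by (simp add: sum_list_sum_nth atLeast0LessThan)

definition tree_segments :: "(nat \<Rightarrow> nat) \<Rightarrow> nat set \<Rightarrow> nat list list \<Rightarrow> nat list list" where
  "tree_segments pa S ps = concat (map (cut_path (tree_edge pa ` S)) ps)"

text \<open>
  Distinct vertices of the tree have distinct edges to their parents, so sums over indices are sums over
  edges, and the edges of the paths are those that are not removed, each occurring once.
\<close>

context
  fixes n :: nat and pa :: "nat \<Rightarrow> nat" and S R :: "nat set" and ps :: "nat list list"
  assumes tree: "rooted_tree n pa" and S: "S \<subseteq> {2..n}" and decomposition: "glued_paths n pa S R ps"
begin

lemma inj_on_tree_edge: "inj_on (tree_edge pa) {2..n}"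
proof (rule inj_onI)
  fix i j assume "i \<in> {2..n}" "j \<in> {2..n}" "tree_edge pa i = tree_edge pa j"
  moreover have "pa i < i" "pa j < j" using tree calculation by (auto simp: rooted_tree_def)
  ultimately show "i = j" by (auto simp: tree_edge_def doubleton_eq_iff)
qed

lemma sum_kept_edges:
  fixes G :: "nat set \<Rightarrow> 'b::comm_monoid_add"
  shows "(\<Sum>p\<leftarrow>ps. \<Sum>e\<leftarrow>filter P (edge_list p). G e)
    = (\<Sum>i\<in>{i \<in> {2..n} - R. P (tree_edge pa i)}. G (tree_edge pa i))"
proof -
  let ?E = "concat (map edge_list ps)"
  have dist: "distinct ?E" using decomposition by (auto simp: glued_paths_def intro: distinct_concat_edge_list)
  have set: "set ?E = tree_edge pa ` ({2..n} - R)"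
    using decomposition by (simp add: glued_paths_def set_edge_list)
  have "(\<Sum>p\<leftarrow>ps. \<Sum>e\<leftarrow>filter P (edge_list p). G e) = (\<Sum>e\<leftarrow>filter P ?E. G e)"
    by (induction ps) auto
  also have "\<dots> = (\<Sum>e\<in>set (filter P ?E). G e)"
    using dist by (intro sum_list_distinct_conv_sum_set) simp
  also have "set (filter P ?E) = tree_edge pa ` {i \<in> {2..n} - R. P (tree_edge pa i)}"
    using set by auto
  also have "(\<Sum>e\<in>\<dots>. G e) = (\<Sum>i\<in>{i \<in> {2..n} - R. P (tree_edge pa i)}. G (tree_edge pa i))"
    by (subst sum.reindex) (auto intro: inj_on_subset[OF inj_on_tree_edge])
  finally show ?thesis .
qed

lemma tree_edge_mem_iff: "i \<in> {2..n} \<Longrightarrow> tree_edge pa i \<in> tree_edge pa ` S \<longleftrightarrow> i \<in> S"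
  by (rule inj_on_image_mem_iff[OF inj_on_tree_edge _ S])

lemma sum_S_edges:
  fixes G :: "nat set \<Rightarrow> 'b::comm_monoid_add"
  shows "(\<Sum>p\<leftarrow>ps. \<Sum>e\<leftarrow>cut_edges (cut_path (tree_edge pa ` S) p). G e) = (\<Sum>i\<in>S. G (tree_edge pa i))"
proof -
  have "{i \<in> {2..n} - R. tree_edge pa i \<in> tree_edge pa ` S} = S"
    using tree_edge_mem_iff S decomposition by (auto simp: glued_paths_def)
  then show ?thesis
    using sum_kept_edges[where P = "\<lambda>e. e \<in> tree_edge pa ` S" and G = G] by (simp add: filter_in_edge_list)
qed

lemma sum_segment_edges:
  fixes G :: "nat set \<Rightarrow> 'b::comm_monoid_add"
  shows "(\<Sum>s\<leftarrow>tree_segments pa S ps. \<Sum>e\<leftarrow>edge_list s. G e) = (\<Sum>i\<in>{2..n} - R - S. G (tree_edge pa i))"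
proof -
  have "{i \<in> {2..n} - R. tree_edge pa i \<notin> tree_edge pa ` S} = {2..n} - R - S"
    by (rule set_eqI) (simp add: tree_edge_mem_iff cong: conj_cong)
  moreover have "(\<Sum>s\<leftarrow>concat xs. \<Sum>e\<leftarrow>edge_list s. G e)
      = (\<Sum>y\<leftarrow>xs. \<Sum>e\<leftarrow>concat (map edge_list y). G e)" for xs
  proof -
    have "(\<Sum>s\<leftarrow>y. \<Sum>e\<leftarrow>edge_list s. G e) = (\<Sum>e\<leftarrow>concat (map edge_list y). G e)" for y
      by (induction y) auto
    then show ?thesis by (induction xs) auto
  qed
  ultimately show ?thesis
    using sum_kept_edges[where P = "\<lambda>e. e \<notin> tree_edge pa ` S" and G = G]
    by (simp add: filter_notin_edge_list tree_segments_def comp_def)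
qed

lemma concat_segments: "concat (tree_segments pa S ps) = concat ps"
proof -
  have "concat (concat (map (cut_path C) qs)) = concat qs" for C and qs :: "nat list list"
    by (induction qs) (auto simp: concat_cut_path)
  then show ?thesis by (simp add: tree_segments_def)
qed

lemma distinct_segments: "distinct (concat (tree_segments pa S ps))"
  and set_segments: "set (concat (tree_segments pa S ps)) = {1..n}"
  using decomposition unfolding concat_segments by (auto simp: glued_paths_def)

lemma segment_nonempty: "s \<in> set (tree_segments pa S ps) \<Longrightarrow> s \<noteq> []"
  using cut_path_segments_nonempty by (auto simp: tree_segments_def)

lemma sum_segments_vertices:
  "(\<Sum>s\<leftarrow>tree_segments pa S ps. \<Sum>i<length s. f (s ! i)) = (\<Sum>i=1..n. f i)"
proof -
  have "(\<Sum>s\<leftarrow>xs. \<Sum>i<length s. f (s ! i)) = (\<Sum>v\<leftarrow>concat xs. f v)" for xs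
    by (induction xs) (auto simp: sum_list_nth_lessThan)
  also have "(\<Sum>v\<leftarrow>concat (tree_segments pa S ps). f v) = (\<Sum>i=1..n. f i)"
    using sum_list_distinct_conv_sum_set[OF distinct_segments] set_segments by metis
  finally show ?thesis .
qed

lemma length_cut_path: "p \<in> set ps \<Longrightarrow> length (cut_path (tree_edge pa ` S) p) = Suc (num_S_edges pa S p)"
proof -
  let ?C = "tree_edge pa ` S"
  assume p: "p \<in> set ps"
  then have "p \<noteq> []" "distinct p" using decomposition by (auto simp: glued_paths_def distinct_concat_iff)
  have "num_S_edges pa S p = card (tree_edge pa ` {e \<in> S. tree_edge pa e \<in> path_edges p})"
    unfolding num_S_edges_def
    by (rule card_image[symmetric], rule inj_on_subset[OF inj_on_tree_edge]) (use S in auto)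
  also have "tree_edge pa ` {e \<in> S. tree_edge pa e \<in> path_edges p} = set (filter (\<lambda>e. e \<in> ?C) (edge_list p))"
    by (auto simp: set_edge_list)
  also have "card \<dots> = length (cut_edges (cut_path ?C p))"
    unfolding filter_in_edge_list[symmetric]
    by (rule distinct_card) (use distinct_edge_list[OF \<open>distinct p\<close>] in simp)
  finally show ?thesis using cut_path_nonempty[OF \<open>p \<noteq> []\<close>, of ?C]
    by (cases "cut_path ?C p") (auto simp: length_cut_edges)
qed

lemma sum_num_S_edges: "(\<Sum>p\<leftarrow>ps. num_S_edges pa S p) = card S"
proof -
  have "(\<Sum>p\<leftarrow>ps. num_S_edges pa S p)
      = (\<Sum>p\<leftarrow>ps. \<Sum>e\<leftarrow>cut_edges (cut_path (tree_edge pa ` S) p). 1)"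
    using length_cut_path by (intro arg_cong[of _ _ sum_list] map_cong) (auto simp: sum_list_triv length_cut_edges)
  then show ?thesis unfolding sum_S_edges by simp
qed

lemma length_segments: "length (tree_segments pa S ps) = card S + length ps"
proof -
  have "length (tree_segments pa S ps) = (\<Sum>p\<leftarrow>ps. num_S_edges pa S p + 1)"
    unfolding tree_segments_def length_concat map_map comp_def
    using length_cut_path by (intro arg_cong[of _ _ sum_list] map_cong) auto
  then show ?thesis unfolding sum_list_addf sum_num_S_edges by (simp add: sum_list_triv)
qed

lemma length_Delta:
  assumes "\<forall>p\<in>set ps. 1 \<le> num_S_edges pa S p"
  shows "length (Delta pa S ps) = 2 * card S"
proof -
  have "length (Delta pa S ps) = (\<Sum>p\<leftarrow>ps. 2 * num_S_edges pa S p)"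
    unfolding Delta_def length_concat map_map comp_def segment_lengths_def
    using length_cut_path assms by (intro arg_cong[of _ _ sum_list] map_cong) (auto simp: length_path_Delta)
  then show ?thesis by (simp add: sum_list_const_mult sum_num_S_edges)
qed

section \<open>The oracle inequality for given noise\<close>

text \<open>
  Add up the bounds for the paths. The edges between the paths carry no noise, and on the left-hand side
  their jumps only enter with a negative sign.
\<close>

lemma tree_compatibility:
  fixes e h :: "nat \<Rightarrow> real"
  assumes S_edges: "\<forall>p\<in>set ps. 1 \<le> num_S_edges pa S p"
    and long: "\<And>s. s \<in> set (tree_segments pa S ps) \<Longrightarrow> 2 \<le> length s"
    and \<tau>: "0 \<le> \<tau>" "\<tau> * sqrt (real n) \<le> t"
    and noise: "\<And>s k. s \<in> set (tree_segments pa S ps) \<Longrightarrow> 0 < k \<Longrightarrow> k < length s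
      \<Longrightarrow> \<bar>bridge (length s) (\<lambda>i. e (s ! i)) k\<bar> \<le> \<tau> * bridge_sd (length s) k"
  shows "2 * (\<Sum>i=1..n. e i * h i)
      + 2 * t * (l1_norm S (tree_diff pa h) - l1_norm ({2..n} - S) (tree_diff pa h))
    \<le> (\<Sum>i=1..n. (h i)\<^sup>2) + 2 * (\<Sum>s\<leftarrow>tree_segments pa S ps. (\<Sum>i<length s. e (s ! i))\<^sup>2 / real (length s))
      + 8 * \<tau>\<^sup>2 * (\<Sum>s\<leftarrow>tree_segments pa S ps. 1 + ln (real (length s)))
      + 4 * t\<^sup>2 * (\<Sum>x\<leftarrow>Delta pa S ps. 1 / x)"
proof -
  define C where "C = tree_edge pa ` S"
  define Q where "Q s = 2 * (\<Sum>i<length s. e (s ! i) * h (s ! i))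
      - 2 * t * (\<Sum>e\<leftarrow>edge_list s. edge_jump h e) - (\<Sum>i<length s. (h (s ! i))\<^sup>2)
      - 2 * ((\<Sum>i<length s. e (s ! i))\<^sup>2 / real (length s)) - 8 * \<tau>\<^sup>2 * (1 + ln (real (length s)))" for s
  have t: "0 \<le> t" using \<tau> by (smt (verit) mult_nonneg_nonneg real_sqrt_ge_zero of_nat_0_le_iff)
  have Q: "Q s + 2 * t * ((if a = 0 then 0 else \<bar>h (hd s)\<bar>) + (if b = 0 then 0 else \<bar>h (last s)\<bar>))
      \<le> 4 * t\<^sup>2 * (1 / real a + 1 / real b)" if s: "s \<in> set (tree_segments pa S ps)" and ab: "a + b = length s" for s a b
  proof -
    have "s \<noteq> []" by (rule segment_nonempty[OF s])
    have "distinct s" using distinct_segments s by (simp add: distinct_concat_iff)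
    moreover have "set s \<subseteq> {1..n}" using set_segments s by auto
    ultimately have "length s \<le> n" by (metis card_atLeastAtMost card_mono diff_Suc_1 distinct_card finite_atLeastAtMost)
    then have "\<tau> * sqrt (real (length s)) \<le> t"
      using mult_left_mono[OF _ \<tau>(1), of "sqrt (real (length s))" "sqrt (real n)"] \<tau>(2) by simp
    moreover have "0 < length s" using \<open>s \<noteq> []\<close> by simp
    moreover have "A - B - C - D - E + P \<le> r" if "A + P \<le> B + C + D + E + r"
      for A B C D E P r :: real using that by linarith
    ultimately show ?thesis
      unfolding Q_def sum_list_edge_list hd_conv_nth[OF \<open>s \<noteq> []\<close>] last_conv_nth[OF \<open>s \<noteq> []\<close>]
      using segment_bound[OF _ ab \<tau>(1) _ noise[OF s], where x = "\<lambda>i. h (s ! i)"] by blast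
  qed
  have path: "(\<Sum>s\<leftarrow>cut_path C p. Q s) + 2 * t * (\<Sum>e\<leftarrow>cut_edges (cut_path C p). edge_jump h e)
      \<le> 4 * t\<^sup>2 * (\<Sum>x\<leftarrow>path_Delta (segment_lengths pa S p). 1 / x)" if p: "p \<in> set ps" for p
    unfolding segment_lengths_def C_def[symmetric]
  proof (rule path_bound_from_segment_bounds[where \<alpha> = "\<lambda>s. \<bar>h (hd s)\<bar>" and \<beta> = "\<lambda>s. \<bar>h (last s)\<bar>"])
    fix s assume "s \<in> set (cut_path C p)"
    then have s: "s \<in> set (tree_segments pa S ps)" using p by (auto simp: tree_segments_def C_def)
    note long = long[OF s] segment_nonempty[OF s]
    show "Q s + 2 * t * \<bar>h (last s)\<bar> \<le> 4 * t\<^sup>2 * (1 / real (length s))"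
      using Q[OF s, of 0 "length s"] long by auto
    show "Q s + 2 * t * \<bar>h (hd s)\<bar> \<le> 4 * t\<^sup>2 * (1 / real (length s))"
      using Q[OF s, of "length s" 0] long by auto
    have halves: "\<lceil>real (length s) / 2\<rceil> = int (length s - length s div 2)"
      "\<lfloor>real (length s) / 2\<rfloor> = int (length s div 2)"
      by (rule ceiling_unique floor_unique; linarith)+
    have "length s - length s div 2 \<noteq> 0" "length s div 2 \<noteq> 0" using long by auto
    then show "Q s + 2 * t * (\<bar>h (hd s)\<bar> + \<bar>h (last s)\<bar>)
      \<le> 4 * t\<^sup>2 * (1 / of_int \<lceil>real (length s) / 2\<rceil> + 1 / of_int \<lfloor>real (length s) / 2\<rfloor>)"
      unfolding halves of_int_of_nat_eq
      using Q[OF s, of "length s - length s div 2" "length s div 2"] by (simp only: if_False)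
  next
    show "2 \<le> length (cut_path C p)"
      using length_cut_path[OF p] S_edges p by (auto simp: C_def)
  qed (use t in \<open>auto simp: edge_jump_pair\<close>)
  have "(\<Sum>p\<leftarrow>ps. (\<Sum>s\<leftarrow>cut_path C p. Q s) + 2 * t * (\<Sum>e\<leftarrow>cut_edges (cut_path C p). edge_jump h e))
      \<le> (\<Sum>p\<leftarrow>ps. 4 * t\<^sup>2 * (\<Sum>x\<leftarrow>path_Delta (segment_lengths pa S p). 1 / x))"
    by (intro sum_list_mono path)
  moreover have "(\<Sum>p\<leftarrow>ps. \<Sum>s\<leftarrow>cut_path C p. Q s) = (\<Sum>s\<leftarrow>tree_segments pa S ps. Q s)"
  proof -
    have "(\<Sum>p\<leftarrow>qs. \<Sum>s\<leftarrow>cut_path C p. Q s) = (\<Sum>s\<leftarrow>concat (map (cut_path C) qs). Q s)" for qs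
      by (induction qs) auto
    then show ?thesis by (simp add: tree_segments_def C_def)
  qed
  moreover have "(\<Sum>p\<leftarrow>ps. \<Sum>x\<leftarrow>path_Delta (segment_lengths pa S p). 1 / x) = (\<Sum>x\<leftarrow>Delta pa S ps. 1 / x)"
  proof -
    have "(\<Sum>p\<leftarrow>qs. \<Sum>x\<leftarrow>path_Delta (segment_lengths pa S p). 1 / x)
        = (\<Sum>x\<leftarrow>concat (map (\<lambda>p. path_Delta (segment_lengths pa S p)) qs). 1 / x)" for qs
      by (induction qs) auto
    then show ?thesis by (simp add: Delta_def)
  qed
  moreover have "(\<Sum>p\<leftarrow>ps. \<Sum>e\<leftarrow>cut_edges (cut_path C p). edge_jump h e) = l1_norm S (tree_diff pa h)"
    unfolding C_def sum_S_edges l1_norm_def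
    by (simp add: tree_edge_def edge_jump_pair tree_diff_def abs_minus_commute)
  ultimately have "(\<Sum>s\<leftarrow>tree_segments pa S ps. Q s) + 2 * t * l1_norm S (tree_diff pa h)
      \<le> 4 * t\<^sup>2 * (\<Sum>x\<leftarrow>Delta pa S ps. 1 / x)"
    by (simp add: sum_list_addf sum_list_const_mult)
  moreover have "(\<Sum>s\<leftarrow>tree_segments pa S ps. Q s) = 2 * (\<Sum>i=1..n. e i * h i) - 2 * t * l1_norm ({2..n} - R - S) (tree_diff pa h)
      - (\<Sum>i=1..n. (h i)\<^sup>2) - 2 * (\<Sum>s\<leftarrow>tree_segments pa S ps. (\<Sum>i<length s. e (s ! i))\<^sup>2 / real (length s))
      - 8 * \<tau>\<^sup>2 * (\<Sum>s\<leftarrow>tree_segments pa S ps. 1 + ln (real (length s)))"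
    unfolding Q_def sum_list_subtractf sum_list_const_mult
      sum_segments_vertices[of "\<lambda>i. e i * h i"] sum_segments_vertices[of "\<lambda>i. (h i)\<^sup>2"] sum_segment_edges l1_norm_def
    by (simp add: tree_edge_def edge_jump_pair tree_diff_def abs_minus_commute)
  moreover have "2 * t * l1_norm ({2..n} - R - S) (tree_diff pa h) \<le> 2 * t * l1_norm ({2..n} - S) (tree_diff pa h)"
    unfolding l1_norm_def using t by (intro mult_left_mono sum_mono2) auto
  ultimately show ?thesis by (simp add: right_diff_distrib)
qed

text \<open>
  Jensen's inequality for the logarithm, proved from its tangent at the mean length \<open>c\<close>.
\<close>

lemma sum_ln_segment_lengths:
  defines "m \<equiv> real (length (tree_segments pa S ps))"
  assumes "0 < m" "0 < n"
  shows "(\<Sum>s\<leftarrow>tree_segments pa S ps. 1 + ln (real (length s))) \<le> m * (1 + ln (real n / m))"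
proof -
  define c where "c = real n / m"
  have c: "0 < c" using assms by (simp add: c_def)
  have "(\<Sum>s\<leftarrow>tree_segments pa S ps. 1 + ln (real (length s))) \<le> (\<Sum>s\<leftarrow>tree_segments pa S ps. real (length s) / c + ln c)"
  proof (rule sum_list_mono)
    fix s assume "s \<in> set (tree_segments pa S ps)"
    then have "0 < real (length s)" using segment_nonempty by auto
    then have "ln (real (length s) / c) \<le> real (length s) / c - 1" using c by (intro ln_le_minus_one) auto
    then show "1 + ln (real (length s)) \<le> real (length s) / c + ln c"
      using c \<open>0 < real (length s)\<close> by (simp add: ln_div)
  qed
  also have "\<dots> = (\<Sum>s\<leftarrow>tree_segments pa S ps. real (length s)) / c + m * ln c"
    by (simp add: sum_list_addf sum_list_triv m_def divide_inverse sum_list_mult_const)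
  also have "(\<Sum>s\<leftarrow>tree_segments pa S ps. real (length s)) = real n"
    using sum_segments_vertices[of "\<lambda>_. 1::real"] by simp
  also have "real n / c = m" using assms by (simp add: c_def)
  finally show ?thesis by (simp add: c_def algebra_simps)
qed


text \<open>
  With \<open>h\<close> the difference of the estimator and \<open>f\<close>, strong minimality leaves the noise term and the
  jumps of \<open>h\<close> on \<open>S\<close> minus those off \<open>S\<close>, which \<open>tree_compatibility\<close> bounds, and provides
  the \<open>\<Sum> h\<^sub>i\<^sup>2\<close> that this bound consumes. The condition on the noise depends neither on \<open>f\<close> nor on \<open>h\<close>, so the bound holds for all \<open>f\<close> at once.
\<close>

lemma tv_estimator_oracle_inequality:
  fixes e f f0 y :: "nat \<Rightarrow> real"
  assumes S_edges: "\<forall>p\<in>set ps. 1 \<le> num_S_edges pa S p"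
    and long: "\<And>s. s \<in> set (tree_segments pa S ps) \<Longrightarrow> 2 \<le> length s"
    and \<tau>: "0 \<le> \<tau>" "\<tau> * sqrt (real n) \<le> real n * lam"
    and noise: "\<And>s k. s \<in> set (tree_segments pa S ps) \<Longrightarrow> 0 < k \<Longrightarrow> k < length s
      \<Longrightarrow> \<bar>bridge (length s) (\<lambda>i. e (s ! i)) k\<bar> \<le> \<tau> * bridge_sd (length s) k"
    and n: "0 < n" and lam: "0 \<le> lam" and f: "f \<in> Rn n"
    and y: "\<And>i. i \<in> {1..n} \<Longrightarrow> y i = f0 i + e i"
  shows "sq_norm_n n (\<lambda>i. tv_estimator n pa lam y i - f0 i)
    \<le> sq_norm_n n (\<lambda>i. f i - f0 i) + 4 * lam * l1_norm ({2..n} - S) (tree_diff pa f)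
      + (2 * (\<Sum>s\<leftarrow>tree_segments pa S ps. (\<Sum>i<length s. e (s ! i))\<^sup>2 / real (length s))
      + 8 * \<tau>\<^sup>2 * (\<Sum>s\<leftarrow>tree_segments pa S ps. 1 + ln (real (length s)))
      + 4 * (real n * lam)\<^sup>2 * (\<Sum>x\<leftarrow>Delta pa S ps. 1 / x)) / real n"
proof -
  define u where "u = tv_estimator n pa lam y"
  define h where "h i = u i - f i" for i
  define t where "t = real n * lam"
  define rest where "rest = 2 * (\<Sum>s\<leftarrow>tree_segments pa S ps. (\<Sum>i<length s. e (s ! i))\<^sup>2 / real (length s))
      + 8 * \<tau>\<^sup>2 * (\<Sum>s\<leftarrow>tree_segments pa S ps. 1 + ln (real (length s)))
      + 4 * t\<^sup>2 * (\<Sum>x\<leftarrow>Delta pa S ps. 1 / x)"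
  have t: "0 \<le> t" using lam by (simp add: t_def)
  let ?TV = "\<lambda>v. l1_norm {2..n} (tree_diff pa v)"
  let ?on = "\<lambda>v. l1_norm S (tree_diff pa v)"
  let ?off = "\<lambda>v. l1_norm ({2..n} - S) (tree_diff pa v)"
  have sq: "real n * sq_norm_n n v = (\<Sum>i=1..n. (v i)\<^sup>2)" for v
    using n by (simp add: sq_norm_n_def)
  have "real n * (tv_objective n pa lam y u + sq_norm_n n (\<lambda>i. f i - u i)) \<le> real n * tv_objective n pa lam y f"
    unfolding u_def by (intro mult_left_mono tv_estimator_strong_minimality n lam f) simp
  then have "(\<Sum>i=1..n. (y i - u i)\<^sup>2) + 2 * t * ?TV u + (\<Sum>i=1..n. (f i - u i)\<^sup>2)
      \<le> (\<Sum>i=1..n. (y i - f i)\<^sup>2) + 2 * t * ?TV f"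
    unfolding tv_objective_def distrib_left sq by (simp add: t_def mult_ac)
  moreover have "(\<Sum>i=1..n. (y i - f i)\<^sup>2) = (\<Sum>i=1..n. (y i - u i)\<^sup>2) - (\<Sum>i=1..n. (u i - f0 i)\<^sup>2)
      + (\<Sum>i=1..n. (f i - f0 i)\<^sup>2) + 2 * (\<Sum>i=1..n. e i * h i)"
    unfolding sum_distrib_left sum.distrib[symmetric] sum_subtractf[symmetric]
    by (intro sum.cong) (auto simp: y h_def power2_eq_square algebra_simps)
  moreover have "(\<Sum>i=1..n. (f i - u i)\<^sup>2) = (\<Sum>i=1..n. (h i)\<^sup>2)"
    by (simp add: h_def power2_commute)
  moreover have "2 * t * (?TV f - ?TV u) \<le> 2 * t * (2 * ?off f + ?on h - ?off h)"
  proof (rule mult_left_mono)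
    have split: "?TV v = ?on v + ?off v" for v
      unfolding l1_norm_def using S by (subst sum.subset_diff[OF S]) auto
    have Dh: "tree_diff pa h i = tree_diff pa u i - tree_diff pa f i" for i
      by (simp add: h_def tree_diff_def)
    have "?on f - ?on u \<le> ?on h"
      unfolding l1_norm_def sum_subtractf[symmetric] by (intro sum_mono) (auto simp: Dh)
    moreover have "?off h \<le> ?off f + ?off u"
      unfolding l1_norm_def sum.distrib[symmetric] by (intro sum_mono) (auto simp: Dh)
    ultimately show "?TV f - ?TV u \<le> 2 * ?off f + ?on h - ?off h" by (simp add: split)
  qed (use t in simp)
  moreover have "2 * (\<Sum>i=1..n. e i * h i) + 2 * t * (?on h - ?off h) \<le> (\<Sum>i=1..n. (h i)\<^sup>2) + rest"
    using tree_compatibility[OF S_edges long \<tau> noise, of h] unfolding rest_def t_def by simp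
  ultimately have "(\<Sum>i=1..n. (u i - f0 i)\<^sup>2) \<le> (\<Sum>i=1..n. (f i - f0 i)\<^sup>2) + 4 * t * ?off f + rest"
    by (simp add: algebra_simps)
  then have "(\<Sum>i=1..n. (u i - f0 i)\<^sup>2) / real n
      \<le> ((\<Sum>i=1..n. (f i - f0 i)\<^sup>2) + 4 * t * ?off f + rest) / real n"
    by (rule divide_right_mono) simp
  then show ?thesis using n unfolding rest_def t_def u_def
    by (simp add: sq_norm_n_def add_divide_distrib)
qed

end

section \<open>Tail bounds for Gaussian vectors\<close>

context prob_space
begin

lemma nn_integral_normal_density:
  assumes "0 < \<sigma>"
  shows "(\<integral>\<^sup>+x. ennreal (normal_density \<mu> \<sigma> x) \<partial>lborel) = 1"
  using assms by (subst nn_integral_eq_integral) auto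

text \<open>
  Both exponential moments below come from the fact that a Gaussian density times the exponential of a
  small quadratic function is a multiple of another Gaussian density.
\<close>

lemma normal_tilt:
  assumes X: "distributed M lborel X (normal_density 0 \<sigma>)" and "0 < \<tau>" "0 \<le> c"
    and g[measurable]: "g \<in> borel_measurable borel"
    and tilt: "\<And>x. normal_density 0 \<sigma> x * exp (g x) = c * normal_density \<mu> \<tau> x"
  shows "(\<integral>\<^sup>+\<omega>. ennreal (exp (g (X \<omega>))) \<partial>M) = ennreal c"
proof -
  have "(\<integral>\<^sup>+\<omega>. ennreal (exp (g (X \<omega>))) \<partial>M)
      = (\<integral>\<^sup>+x. ennreal (normal_density 0 \<sigma> x) * ennreal (exp (g x)) \<partial>lborel)"
    by (subst distributed_nn_integral[OF X]) auto
  also have "\<dots> = (\<integral>\<^sup>+x. ennreal c * ennreal (normal_density \<mu> \<tau> x) \<partial>lborel)"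
    using assms(3) by (intro nn_integral_cong) (simp flip: ennreal_mult' add: tilt)
  also have "\<dots> = ennreal c"
    using nn_integral_normal_density[OF assms(2)] by (simp add: nn_integral_cmult)
  finally show ?thesis .
qed

lemma normal_mgf:
  assumes X: "distributed M lborel X (normal_density 0 \<sigma>)" and \<sigma>: "0 < \<sigma>"
  shows "(\<integral>\<^sup>+\<omega>. ennreal (exp (u * X \<omega>)) \<partial>M) = ennreal (exp (u\<^sup>2 * \<sigma>\<^sup>2 / 2))"
proof (rule normal_tilt[OF X \<sigma>])
  fix x
  have "- x\<^sup>2 / (2 * \<sigma>\<^sup>2) + u * x = u\<^sup>2 * \<sigma>\<^sup>2 / 2 + - (x - u * \<sigma>\<^sup>2)\<^sup>2 / (2 * \<sigma>\<^sup>2)"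
    using \<sigma> by (simp add: field_simps power2_eq_square)
  then show "normal_density 0 \<sigma> x * exp (u * x)
      = exp (u\<^sup>2 * \<sigma>\<^sup>2 / 2) * normal_density (u * \<sigma>\<^sup>2) \<sigma> x"
    by (simp add: normal_density_def flip: exp_add)
qed auto

lemma normal_exp_square:
  assumes X: "distributed M lborel X (normal_density 0 \<sigma>)" and \<sigma>: "0 < \<sigma>"
  shows "(\<integral>\<^sup>+\<omega>. ennreal (exp ((X \<omega>)\<^sup>2 / (4 * \<sigma>\<^sup>2))) \<partial>M) = ennreal (sqrt 2)"
proof (rule normal_tilt[OF X, of "sqrt 2 * \<sigma>"])
  fix x
  have "- x\<^sup>2 / (2 * \<sigma>\<^sup>2) + x\<^sup>2 / (4 * \<sigma>\<^sup>2) = - x\<^sup>2 / (2 * (sqrt 2 * \<sigma>)\<^sup>2)"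
    using \<sigma> by (simp add: field_simps power2_eq_square)
  then show "normal_density 0 \<sigma> x * exp (x\<^sup>2 / (4 * \<sigma>\<^sup>2)) = sqrt 2 * normal_density 0 (sqrt 2 * \<sigma>) x"
    using \<sigma> by (simp add: normal_density_def power_mult_distrib real_sqrt_mult flip: exp_add)
      (simp add: field_simps)
qed (use \<sigma> in auto)

text \<open>
  Chernoff's bound with the optimal parameter \<open>l\<close>, from the product form of the exponential moment.
\<close>

lemma linear_combination_upper_tail:
  assumes I: "finite I" "indep_vars (\<lambda>_. borel) X I"
    and X: "\<And>i. i \<in> I \<Longrightarrow> distributed M lborel (X i) (normal_density 0 \<sigma>)" and \<sigma>: "0 < \<sigma>"
    and q: "0 < (\<Sum>i\<in>I. (a i)\<^sup>2)" and r: "0 < r"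
  shows "measure M {\<omega> \<in> space M. r \<le> (\<Sum>i\<in>I. a i * X i \<omega>)}
    \<le> exp (- r\<^sup>2 / (2 * \<sigma>\<^sup>2 * (\<Sum>i\<in>I. (a i)\<^sup>2)))"
proof -
  define q where "q = (\<Sum>i\<in>I. (a i)\<^sup>2)"
  define l where "l = r / (\<sigma>\<^sup>2 * q)"
  have l: "0 < l" using q r \<sigma> by (simp add: l_def q_def)
  have [measurable]: "X i \<in> borel_measurable M" if "i \<in> I" for i
    using I(2) that by (auto simp: indep_vars_def)
  have ind: "indep_vars (\<lambda>_. borel) (\<lambda>i \<omega>. ennreal (exp ((l * a i) * X i \<omega>))) I"
    by (rule indep_vars_compose2[OF I(2)]) auto
  have "(\<integral>\<^sup>+\<omega>. ennreal (exp (l * (\<Sum>i\<in>I. a i * X i \<omega>))) \<partial>M)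
      = (\<integral>\<^sup>+\<omega>. (\<Prod>i\<in>I. ennreal (exp ((l * a i) * X i \<omega>))) \<partial>M)"
    using I(1) by (simp add: prod_ennreal exp_sum sum_distrib_left mult.assoc)
  also have "\<dots> = (\<Prod>i\<in>I. ennreal (exp ((l * a i)\<^sup>2 * \<sigma>\<^sup>2 / 2)))"
    by (subst indep_vars_nn_integral[OF I(1) ind]) (auto intro!: prod.cong normal_mgf X \<sigma>)
  also have "\<dots> = ennreal (exp (\<Sum>i\<in>I. (l * a i)\<^sup>2 * \<sigma>\<^sup>2 / 2))"
    using I(1) by (simp add: prod_ennreal exp_sum)
  also have "(\<Sum>i\<in>I. (l * a i)\<^sup>2 * \<sigma>\<^sup>2 / 2) = l\<^sup>2 * q * \<sigma>\<^sup>2 / 2"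
    by (simp add: q_def power_mult_distrib sum_distrib_left sum_distrib_right sum_divide_distrib)
  finally have mgf: "(\<integral>\<^sup>+\<omega>. ennreal (exp (l * (\<Sum>i\<in>I. a i * X i \<omega>))) \<partial>M)
      = ennreal (exp (l\<^sup>2 * q * \<sigma>\<^sup>2 / 2))" .
  have "emeasure M {\<omega> \<in> space M. r \<le> (\<Sum>i\<in>I. a i * X i \<omega>)}
    \<le> ennreal (exp (- l * r)) * (\<integral>\<^sup>+\<omega>. ennreal (exp (l * (\<Sum>i\<in>I. a i * X i \<omega>))) * indicator (space M) \<omega> \<partial>M)"
    by (rule Chernoff_ineq_nn_integral_ge[OF l]) auto
  also have "(\<integral>\<^sup>+\<omega>. ennreal (exp (l * (\<Sum>i\<in>I. a i * X i \<omega>))) * indicator (space M) \<omega> \<partial>M)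
      = (\<integral>\<^sup>+\<omega>. ennreal (exp (l * (\<Sum>i\<in>I. a i * X i \<omega>))) \<partial>M)"
    by (intro nn_integral_cong) simp
  also have "ennreal (exp (- l * r)) * \<dots> = ennreal (exp (- l * r + l\<^sup>2 * q * \<sigma>\<^sup>2 / 2))"
    unfolding mgf exp_add by (simp add: ennreal_mult)
  also have "- l * r + l\<^sup>2 * q * \<sigma>\<^sup>2 / 2 = - r\<^sup>2 / (2 * \<sigma>\<^sup>2 * q)"
    using q r \<sigma> unfolding l_def q_def[symmetric] by (simp add: field_simps power2_eq_square)
  finally show ?thesis unfolding q_def by (simp add: emeasure_eq_measure)
qed

text \<open>
  The combination is indexed by positions \<open>j\<close> in a segment, which \<open>f\<close> maps to vertices.
\<close>

lemma linear_combination_tail: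
  assumes I: "finite I" "indep_vars (\<lambda>_. borel) X I"
    and X: "\<And>i. i \<in> I \<Longrightarrow> distributed M lborel (X i) (normal_density 0 \<sigma>)" and \<sigma>: "0 < \<sigma>"
    and J: "inj_on f J" "f ` J \<subseteq> I"
    and q: "0 < (\<Sum>j\<in>J. (a j)\<^sup>2)" and r: "0 < r"
  shows "measure M {\<omega> \<in> space M. r \<le> \<bar>\<Sum>j\<in>J. a j * X (f j) \<omega>\<bar>}
    \<le> 2 * exp (- r\<^sup>2 / (2 * \<sigma>\<^sup>2 * (\<Sum>j\<in>J. (a j)\<^sup>2)))"
proof -
  define b where "b i = a (the_inv_into J f i)" for i
  have ind: "indep_vars (\<lambda>_. borel) X (f ` J)" by (rule indep_vars_subset[OF I(2) J(2)])
  have fin: "finite (f ` J)" using I(1) J(2) by (rule finite_subset[rotated])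
  have b: "b (f j) = a j" if "j \<in> J" for j using that J(1) by (simp add: b_def the_inv_into_f_f)
  have sums: "(\<Sum>i\<in>f ` J. (b i)\<^sup>2) = (\<Sum>j\<in>J. (a j)\<^sup>2)"
      "(\<Sum>i\<in>f ` J. b i * X i \<omega>) = (\<Sum>j\<in>J. a j * X (f j) \<omega>)" for \<omega>
    by (auto simp: sum.reindex[OF J(1)] b intro!: sum.cong)
  have [measurable]: "X i \<in> borel_measurable M" if "i \<in> f ` J" for i
    using ind that by (auto simp: indep_vars_def)
  have X': "distributed M lborel (X i) (normal_density 0 \<sigma>)" if "i \<in> f ` J" for i
    using X J that by auto
  let ?S = "\<lambda>\<omega>. \<Sum>i\<in>f ` J. b i * X i \<omega>"
  have up: "measure M {\<omega> \<in> space M. r \<le> ?S \<omega>}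
      \<le> exp (- r\<^sup>2 / (2 * \<sigma>\<^sup>2 * (\<Sum>i\<in>f ` J. (b i)\<^sup>2)))"
    using q r by (intro linear_combination_upper_tail fin ind X' \<sigma>) (auto simp: sums)
  have dn: "measure M {\<omega> \<in> space M. r \<le> (\<Sum>i\<in>f ` J. - b i * X i \<omega>)}
      \<le> exp (- r\<^sup>2 / (2 * \<sigma>\<^sup>2 * (\<Sum>i\<in>f ` J. (- b i)\<^sup>2)))"
    using q r by (intro linear_combination_upper_tail fin ind X' \<sigma>) (auto simp: sums)
  have "{\<omega> \<in> space M. r \<le> \<bar>?S \<omega>\<bar>}
      = {\<omega> \<in> space M. r \<le> ?S \<omega>} \<union> {\<omega> \<in> space M. r \<le> (\<Sum>i\<in>f ` J. - b i * X i \<omega>)}"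
    by (auto simp: sum_negf)
  also have "measure M \<dots> \<le> measure M {\<omega> \<in> space M. r \<le> ?S \<omega>}
      + measure M {\<omega> \<in> space M. r \<le> (\<Sum>i\<in>f ` J. - b i * X i \<omega>)}"
    by (rule measure_Un_le) measurable
  finally show ?thesis using up dn by (simp add: sums)
qed

text \<open>
  The normalised block sums are independent and normal, so the sum of their squares, divided by
  \<open>\<sigma>\<^sup>2\<close>, is chi-square distributed. Taking the exponential moment at \<open>1/4\<close> gives the factor \<open>4\<close>
  in front of \<open>u\<close> and \<open>2 ln 2\<close> per degree of freedom.
\<close>

lemma block_sums_chi_square_tail:
  assumes I: "indep_vars (\<lambda>_. borel) X I"
    and X: "\<And>i. i \<in> I \<Longrightarrow> distributed M lborel (X i) (normal_density 0 \<sigma>)" and \<sigma>: "0 < \<sigma>"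
    and L: "finite L" "disjoint_family_on K L"
    and K: "\<And>j. j \<in> L \<Longrightarrow> K j \<subseteq> I" "\<And>j. j \<in> L \<Longrightarrow> finite (K j)" "\<And>j. j \<in> L \<Longrightarrow> K j \<noteq> {}"
  shows "measure M {\<omega> \<in> space M. \<sigma>\<^sup>2 * (4 * u + 2 * real (card L) * ln 2)
      \<le> (\<Sum>j\<in>L. (\<Sum>i\<in>K j. X i \<omega>)\<^sup>2 / real (card (K j)))} \<le> exp (- u)"
proof -
  define l where "l = 1 / (4 * \<sigma>\<^sup>2)"
  have l: "0 < l" using \<sigma> by (simp add: l_def)
  have [measurable]: "X i \<in> borel_measurable M" if "i \<in> I" for i
    using I that by (auto simp: indep_vars_def)
  have [measurable]: "X i \<in> borel_measurable M" if "i \<in> K j" "j \<in> L" for i j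
    using K(1)[OF that(2)] that by auto
  let ?V = "\<lambda>\<omega>. \<Sum>j\<in>L. (\<Sum>i\<in>K j. X i \<omega>)\<^sup>2 / real (card (K j))"
  let ?G = "\<lambda>j y. ennreal (exp (l * ((\<Sum>i\<in>K j. y i)\<^sup>2 / real (card (K j)))))"
  have "indep_vars (\<lambda>_. borel) (\<lambda>j \<omega>. ?G j (restrict (\<lambda>i. X i \<omega>) (K j))) L"
    by (rule indep_vars_compose2[OF indep_vars_restrict[OF I K(1) L(2)]]) auto
  then have ind: "indep_vars (\<lambda>_. borel) (\<lambda>j \<omega>. ?G j (\<lambda>i. X i \<omega>)) L"
    by (simp cong: sum.cong)
  have one: "(\<integral>\<^sup>+\<omega>. ?G j (\<lambda>i. X i \<omega>) \<partial>M) = ennreal (sqrt 2)" if j: "j \<in> L" for j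
  proof -
    have c: "0 < real (card (K j))" using K j by (simp add: card_gt_0_iff)
    have "distributed M lborel (\<lambda>\<omega>. \<Sum>i\<in>K j. X i \<omega>)
        (normal_density (\<Sum>i\<in>K j. 0) (sqrt (\<Sum>i\<in>K j. \<sigma>\<^sup>2)))"
      using K[OF j] \<sigma> X by (intro sum_indep_normal indep_vars_subset[OF I]) auto
    then have D: "distributed M lborel (\<lambda>\<omega>. \<Sum>i\<in>K j. X i \<omega>)
        (normal_density 0 (sqrt (real (card (K j)) * \<sigma>\<^sup>2)))" by simp
    have "0 < sqrt (real (card (K j)) * \<sigma>\<^sup>2)" using c \<sigma> by simp
    from normal_exp_square[OF D this] c show ?thesis
      by (simp add: l_def mult.commute mult.left_commute)
  qed
  have "(\<integral>\<^sup>+\<omega>. ennreal (exp (l * ?V \<omega>)) \<partial>M) = (\<integral>\<^sup>+\<omega>. (\<Prod>j\<in>L. ?G j (\<lambda>i. X i \<omega>)) \<partial>M)"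
    using L(1) by (simp add: prod_ennreal exp_sum sum_distrib_left)
  also have "\<dots> = (\<Prod>j\<in>L. \<integral>\<^sup>+\<omega>. ?G j (\<lambda>i. X i \<omega>) \<partial>M)"
    by (rule indep_vars_nn_integral[OF L(1) ind]) simp
  also have "\<dots> = (\<Prod>j\<in>L. ennreal (sqrt 2))"
    by (rule prod.cong[OF refl one])
  also have "\<dots> = ennreal (exp (real (card L) * ln 2 / 2))"
    by (simp add: ennreal_power exp_of_nat_mult flip: ln_sqrt times_divide_eq_right)
  finally have mgf: "(\<integral>\<^sup>+\<omega>. ennreal (exp (l * ?V \<omega>)) \<partial>M) = ennreal (exp (real (card L) * ln 2 / 2))" .
  define r where "r = \<sigma>\<^sup>2 * (4 * u + 2 * real (card L) * ln 2)"
  have "emeasure M {\<omega> \<in> space M. r \<le> ?V \<omega>}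
    \<le> ennreal (exp (- l * r)) * (\<integral>\<^sup>+\<omega>. ennreal (exp (l * ?V \<omega>)) * indicator (space M) \<omega> \<partial>M)"
    by (rule Chernoff_ineq_nn_integral_ge[OF l]) auto
  also have "(\<integral>\<^sup>+\<omega>. ennreal (exp (l * ?V \<omega>)) * indicator (space M) \<omega> \<partial>M)
      = (\<integral>\<^sup>+\<omega>. ennreal (exp (l * ?V \<omega>)) \<partial>M)"
    by (intro nn_integral_cong) simp
  also have "ennreal (exp (- l * r)) * \<dots> = ennreal (exp (- l * r + real (card L) * ln 2 / 2))"
    unfolding mgf exp_add by (simp add: ennreal_mult)
  also have "- l * r + real (card L) * ln 2 / 2 = - u"
    using \<sigma> unfolding l_def r_def by (simp add: field_simps)
  finally show ?thesis unfolding r_def by (simp add: emeasure_eq_measure)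
qed

end

section \<open>The noise event and the theorem\<close>

lemma bridge_eq_sum:
  assumes "k \<le> d"
  shows "bridge d x k = (\<Sum>i<d. (of_bool (i < k) - real k / real d) * x i)"
proof -
  have "(\<Sum>i<d. of_bool (i < k) * x i) = (\<Sum>i<k. x i)"
    using assms by (intro sum.mono_neutral_cong_right) auto
  then show ?thesis by (simp add: bridge_def left_diff_distrib sum_subtractf sum_distrib_left)
qed

lemma sum_bridge_coefficients_square:
  assumes "0 < d" "k \<le> d"
  shows "(\<Sum>i<d. (of_bool (i < k) - real k / real d)\<^sup>2) = (bridge_sd d k)\<^sup>2"
proof -
  have "(\<Sum>i<d. of_bool (i < k)) = real k"
    using assms(2) sum.mono_neutral_cong_right[of "{..<d}" "{..<k}" "\<lambda>i. of_bool (i < k)" "\<lambda>_. 1::real"] by simp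
  moreover have "(of_bool (i < k) - real k / real d)\<^sup>2
      = of_bool (i < k) * (1 - 2 * (real k / real d)) + (real k / real d)\<^sup>2" for i
    by (simp add: power2_eq_square algebra_simps)
  ultimately have "(\<Sum>i<d. (of_bool (i < k) - real k / real d)\<^sup>2)
      = real k * (1 - 2 * (real k / real d)) + real d * (real k / real d)\<^sup>2"
    by (simp add: sum.distrib flip: sum_distrib_right)
  also have "\<dots> = real k * real (d - k) / real d"
    using assms by (simp add: of_nat_diff field_simps power2_eq_square)
  finally show ?thesis by (simp add: bridge_sd_def)
qed

context prob_space
begin

lemma iso_normal_components:
  assumes n: "1 \<le> n" and \<sigma>: "0 < \<sigma>"
    and \<epsilon>: "\<epsilon> \<in> measurable M (\<Pi>\<^sub>M i\<in>{1..n}. borel)"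
    and law: "distr M (\<Pi>\<^sub>M i\<in>{1..n}. borel) \<epsilon> = iso_normal n \<sigma>"
  shows "indep_vars (\<lambda>_. borel) (\<lambda>i \<omega>. \<epsilon> \<omega> i) {1..n}"
    and "i \<in> {1..n} \<Longrightarrow> distributed M lborel (\<lambda>\<omega>. \<epsilon> \<omega> i) (normal_density 0 \<sigma>)"
proof -
  let ?N = "density lborel (normal_density 0 \<sigma>)"
  have meas: "(\<lambda>\<omega>. \<epsilon> \<omega> i) \<in> borel_measurable M" if "i \<in> {1..n}" for i
    by (rule measurable_compose[OF \<epsilon> measurable_component_singleton[OF that]])
  have comp: "distr M borel (\<lambda>\<omega>. \<epsilon> \<omega> i) = ?N" if i: "i \<in> {1..n}" for i
  proof -
    have "distr M borel (\<lambda>\<omega>. \<epsilon> \<omega> i) = distr (distr M (\<Pi>\<^sub>M i\<in>{1..n}. borel) \<epsilon>) borel (\<lambda>x. x i)"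
      using i by (subst distr_distr[OF _ \<epsilon>]) (auto simp: comp_def)
    also have "\<dots> = distr (\<Pi>\<^sub>M i\<in>{1..n}. ?N) ?N (\<lambda>x. x i)"
      unfolding law iso_normal_def by (intro distr_cong) auto
    also have "\<dots> = ?N"
      using i \<sigma> by (intro distr_PiM_component prob_space_normal_density) auto
    finally show ?thesis .
  qed
  have "restrict (\<epsilon> \<omega>) {1..n} = \<epsilon> \<omega>" if "\<omega> \<in> space M" for \<omega>
    using measurable_space[OF \<epsilon> that] unfolding space_PiM by (rule PiE_restrict)
  then have "distr M (\<Pi>\<^sub>M i\<in>{1..n}. borel) (\<lambda>\<omega>. \<lambda>i\<in>{1..n}. \<epsilon> \<omega> i) = distr M (\<Pi>\<^sub>M i\<in>{1..n}. borel) \<epsilon>"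
    by (intro distr_cong) auto
  also have "\<dots> = (\<Pi>\<^sub>M i\<in>{1..n}. distr M borel (\<lambda>\<omega>. \<epsilon> \<omega> i))"
    unfolding law iso_normal_def using comp by (intro PiM_cong) auto
  finally show "indep_vars (\<lambda>_. borel) (\<lambda>i \<omega>. \<epsilon> \<omega> i) {1..n}"
    using n meas by (subst indep_vars_iff_distr_eq_PiM') auto
  assume i: "i \<in> {1..n}"
  have "distr M lborel (\<lambda>\<omega>. \<epsilon> \<omega> i) = distr M borel (\<lambda>\<omega>. \<epsilon> \<omega> i)"
    by (intro distr_cong) auto
  then show "distributed M lborel (\<lambda>\<omega>. \<epsilon> \<omega> i) (normal_density 0 \<sigma>)"
    using comp[OF i] meas[OF i] by (simp add: distributed_def)
qed

text \<open>
  The sum of the normalised squared block sums reaches its bound with probability at most \<open>\<delta> / 2\<close>. Each of the at most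
  \<open>N\<close> bridge values reaches \<open>sqrt (2 L)\<close> standard deviations with probability at most
  \<open>2 exp (- L) = \<delta> / (2 N)\<close>.
\<close>

lemma segment_noise_event:
  fixes segs :: "'i list list"
  assumes ind: "indep_vars (\<lambda>_. borel) X I" and I: "finite I"
    and X: "\<And>i. i \<in> I \<Longrightarrow> distributed M lborel (X i) (normal_density 0 \<sigma>)" and \<sigma>: "0 < \<sigma>"
    and segs: "distinct (concat segs)" "set (concat segs) \<subseteq> I" "[] \<notin> set segs"
    and \<delta>: "0 < \<delta>" "\<delta> < 1" and N: "(\<Sum>s\<leftarrow>segs. real (length s - 1)) \<le> N" "1 \<le> N"
  defines "L \<equiv> ln (4 * N / \<delta>)"
  shows "\<exists>G\<in>sets M. 1 - \<delta> \<le> measure M G \<and> (\<forall>\<omega>\<in>G.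
      (\<Sum>s\<leftarrow>segs. (\<Sum>i<length s. X (s ! i) \<omega>)\<^sup>2 / real (length s))
        \<le> \<sigma>\<^sup>2 * (4 * ln (2 / \<delta>) + 2 * real (length segs) * ln 2) \<and>
      (\<forall>s\<in>set segs. \<forall>k. 0 < k \<longrightarrow> k < length s \<longrightarrow>
        \<bar>bridge (length s) (\<lambda>i. X (s ! i) \<omega>) k\<bar> \<le> \<sigma> * sqrt (2 * L) * bridge_sd (length s) k))"
proof -
  define V where "V \<omega> = (\<Sum>s\<leftarrow>segs. (\<Sum>i<length s. X (s ! i) \<omega>)\<^sup>2 / real (length s))" for \<omega>
  define A where "A = {\<omega> \<in> space M. \<sigma>\<^sup>2 * (4 * ln (2 / \<delta>) + 2 * real (length segs) * ln 2) \<le> V \<omega>}"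
  define B where "B = (\<lambda>(j, k). {\<omega> \<in> space M. \<sigma> * sqrt (2 * L) * bridge_sd (length (segs ! j)) k
      \<le> \<bar>bridge (length (segs ! j)) (\<lambda>i. X (segs ! j ! i) \<omega>) k\<bar>})"
  define K where "K = (SIGMA j:{..<length segs}. {1..<length (segs ! j)})"
  have L: "0 < L" unfolding L_def using \<delta> N by (intro ln_gt_zero) (simp add: field_simps)
  have seg: "segs ! j \<noteq> []" "distinct (segs ! j)" "set (segs ! j) \<subseteq> I" if "j < length segs" for j
    using nth_mem[OF that] segs by (auto simp: distinct_concat_iff)
  have "distinct segs" using segs by (simp add: distinct_concat_iff removeAll_id)
  then have disj: "disjoint_family_on (\<lambda>j. set (segs ! j)) {..<length segs}"
    using segs(1) unfolding disjoint_family_on_def distinct_concat_iff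
    by (simp add: nth_eq_iff_index_eq)
  have V_eq: "V \<omega> = (\<Sum>j<length segs. (\<Sum>i\<in>set (segs ! j). X i \<omega>)\<^sup>2 / real (card (set (segs ! j))))" for \<omega>
    unfolding V_def sum_list_nth_lessThan
  proof (rule sum.cong)
    fix j assume "j \<in> {..<length segs}"
    then have "distinct (segs ! j)" using seg by simp
    then show "(\<Sum>i<length (segs ! j). X (segs ! j ! i) \<omega>)\<^sup>2 / real (length (segs ! j))
        = (\<Sum>i\<in>set (segs ! j). X i \<omega>)\<^sup>2 / real (card (set (segs ! j)))"
      using sum_list_distinct_conv_sum_set[of "segs ! j" "\<lambda>i. X i \<omega>"]
        sum_list_nth_lessThan[of "\<lambda>i. X i \<omega>" "segs ! j"] by (simp add: distinct_card)
  qed simp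
  have [measurable]: "X (segs ! j ! i) \<in> borel_measurable M" if "j < length segs" "i < length (segs ! j)" for i j
    using ind seg(3)[OF that(1)] nth_mem[OF that(2)] by (auto simp: indep_vars_def)
  have "A = {\<omega> \<in> space M. \<sigma>\<^sup>2 * (4 * ln (2 / \<delta>) + 2 * real (card {..<length segs}) * ln 2)
      \<le> (\<Sum>j<length segs. (\<Sum>i\<in>set (segs ! j). X i \<omega>)\<^sup>2 / real (card (set (segs ! j))))}"
    by (simp add: A_def V_eq)
  also have "measure M \<dots> \<le> exp (- ln (2 / \<delta>))"
    by (rule block_sums_chi_square_tail[OF ind X \<sigma> _ disj]) (use seg in auto)
  also have "exp (- ln (2 / \<delta>)) = \<delta> / 2" using \<delta> by (simp add: exp_minus)
  finally have PA: "measure M A \<le> \<delta> / 2" .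
  have A_sets: "A \<in> sets M" unfolding A_def V_def sum_list_nth_lessThan by measurable
  have B_sets: "B x \<in> sets M" if "x \<in> K" for x
    using that unfolding B_def K_def bridge_def by (auto simp: case_prod_beta)
  have PB: "measure M (B x) \<le> \<delta> / (2 * N)" if x: "x \<in> K" for x
  proof -
    obtain j k where jk: "x = (j, k)" "j < length segs" "0 < k" "k < length (segs ! j)"
      using x by (auto simp: K_def)
    let ?s = "segs ! j" and ?d = "length (segs ! j)"
    have "0 < real k * real (?d - k) / real ?d" using jk by (intro divide_pos_pos mult_pos_pos) auto
    then have pos: "0 < bridge_sd ?d k" unfolding bridge_sd_def by (rule real_sqrt_gt_zero)
    have q: "(\<Sum>i<?d. (of_bool (i < k) - real k / real ?d)\<^sup>2) = (bridge_sd ?d k)\<^sup>2"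
      using jk by (intro sum_bridge_coefficients_square) auto
    let ?r = "\<sigma> * sqrt (2 * L) * bridge_sd ?d k"
    have inj: "inj_on ((!) ?s) {..<?d}" using seg(2)[OF jk(2)] by (auto intro: inj_on_nth)
    have img: "(!) ?s ` {..<?d} \<subseteq> I" using seg(3)[OF jk(2)] by (auto dest: nth_mem)
    have "measure M {\<omega> \<in> space M. ?r \<le> \<bar>\<Sum>i<?d. (of_bool (i < k) - real k / real ?d) * X (?s ! i) \<omega>\<bar>}
        \<le> 2 * exp (- ?r\<^sup>2 / (2 * \<sigma>\<^sup>2 * (\<Sum>i<?d. (of_bool (i < k) - real k / real ?d)\<^sup>2)))"
      by (rule linear_combination_tail[OF I ind X \<sigma> inj img]) (use pos L \<sigma> q in auto)
    also have "- ?r\<^sup>2 / (2 * \<sigma>\<^sup>2 * (\<Sum>i<?d. (of_bool (i < k) - real k / real ?d)\<^sup>2)) = - L"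
      unfolding q using pos L \<sigma> by (simp add: power_mult_distrib)
    also have "2 * exp (- L) = \<delta> / (2 * N)"
      using \<delta> N by (simp add: L_def exp_minus)
    finally show ?thesis using jk by (simp add: B_def bridge_eq_sum)
  qed
  have K: "finite K" "real (card K) \<le> N"
    using N(1) by (simp_all add: K_def sum_list_nth_lessThan)
  have "measure M (\<Union>x\<in>K. B x) \<le> (\<Sum>x\<in>K. measure M (B x))"
    using B_sets K(1) by (intro finite_measure_subadditive_finite) auto
  also have "\<dots> \<le> real (card K) * (\<delta> / (2 * N))"
    by (rule sum_bounded_above[OF PB])
  also have "\<dots> \<le> N * (\<delta> / (2 * N))"
    using K(2) \<delta> N by (intro mult_right_mono) auto
  also have "\<dots> = \<delta> / 2" using N by simp
  finally have PU: "measure M (\<Union>x\<in>K. B x) \<le> \<delta> / 2" .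
  have U_sets: "(\<Union>x\<in>K. B x) \<in> sets M" using B_sets K(1) by auto
  define G where "G = space M - (A \<union> (\<Union>x\<in>K. B x))"
  show ?thesis
  proof (intro bexI[of _ G] conjI ballI allI impI)
    show "G \<in> sets M" using A_sets U_sets by (auto simp: G_def)
    have "measure M (A \<union> (\<Union>x\<in>K. B x)) \<le> \<delta>"
      using measure_Un_le[OF A_sets U_sets] PA PU by linarith
    then show "1 - \<delta> \<le> measure M G"
      unfolding G_def using A_sets U_sets by (subst prob_compl) auto
  next
    fix \<omega> assume "\<omega> \<in> G"
    then show "(\<Sum>s\<leftarrow>segs. (\<Sum>i<length s. X (s ! i) \<omega>)\<^sup>2 / real (length s))
      \<le> \<sigma>\<^sup>2 * (4 * ln (2 / \<delta>) + 2 * real (length segs) * ln 2)"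
      by (auto simp: G_def A_def V_def)
  next
    fix \<omega> s k assume "\<omega> \<in> G" "s \<in> set segs" "0 < k" "k < length s"
    then obtain j where "j < length segs" "s = segs ! j" by (auto simp: in_set_conv_nth)
    then have "(j, k) \<in> K" using \<open>0 < k\<close> \<open>k < length s\<close> by (auto simp: K_def)
    then show "\<bar>bridge (length s) (\<lambda>i. X (s ! i) \<omega>) k\<bar> \<le> \<sigma> * sqrt (2 * L) * bridge_sd (length s) k"
      using \<open>\<omega> \<in> G\<close> \<open>s = segs ! j\<close> by (force simp: G_def B_def)
  qed
qed

end

text \<open>
  With \<open>m = s + g\<close> and \<open>r = ln (n / m)\<close>, the terms without \<open>H\<close> and \<open>l\<close> on the left are multiples of
  \<open>\<sigma>\<^sup>2 L m r\<close> as soon as \<open>L\<close> and \<open>r\<close> are at least \<open>1\<close>: the degrees of freedom contribute \<open>4\<close>,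
  the variation of the weights \<open>32\<close>, and \<open>40\<close> are available.
\<close>

lemma remainder_bound:
  fixes n s g :: nat
  assumes L: "1 \<le> L" and n: "4 * (s + g) \<le> n" and s: "0 < s" and g: "0 < g" and \<gamma>: "0 < \<gamma>"
    and V: "V \<le> \<sigma>\<^sup>2 * (4 * l + 2 * real (s + g) * ln 2)"
    and W: "W \<le> real (s + g) * (1 + ln (real n / real (s + g)))"
  shows "(2 * V + 8 * (\<sigma> * sqrt (2 * L))\<^sup>2 * W
      + 4 * (real n * (\<gamma> * \<sigma> * sqrt (2 * L / real n)))\<^sup>2 * H) / real n
    \<le> 8 * l * \<sigma>\<^sup>2 / real n + 4 * \<sigma>\<^sup>2 * (real s + 1) / real n
      + 8 * \<sigma>\<^sup>2 * L * (2 * \<gamma>\<^sup>2 * (H / 2)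
        + 5 * (real (s + g) / real n) * ln (real n / real (s + g)))"
proof -
  define m where "m = real (s + g)"
  define r where "r = ln (real n / m)"
  have m: "0 < m" using s by (simp add: m_def)
  have n0: "0 < real n" using n s by simp
  have "exp 1 \<le> real n / m"
  proof -
    have "exp 1 * m \<le> 3 * m" using exp_le m by (intro mult_right_mono) auto
    also have "\<dots> \<le> real n" using of_nat_mono[OF n, where 'a = real] by (simp add: m_def)
    finally show ?thesis using m by (simp add: pos_le_divide_eq)
  qed
  then have r: "1 \<le> r" unfolding r_def using ln_ge_iff[of "real n / m" 1] m n0 by simp
  have sq: "(\<sigma> * sqrt (2 * L))\<^sup>2 = 2 * \<sigma>\<^sup>2 * L" using L by (simp add: power_mult_distrib)
  have sq': "(real n * (\<gamma> * \<sigma> * sqrt (2 * L / real n)))\<^sup>2 = real n * (2 * \<gamma>\<^sup>2 * \<sigma>\<^sup>2 * L)"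
  proof -
    have "(sqrt (2 * L / real n))\<^sup>2 = 2 * L / real n" using L by simp
    then show ?thesis unfolding power_mult_distrib using n0 by (simp add: power2_eq_square)
  qed
  define P where "P = \<sigma>\<^sup>2 * L * m * r"
  have P: "0 \<le> P" using L m r by (simp add: P_def)
  have "2 * V \<le> 8 * l * \<sigma>\<^sup>2 + 4 * P"
  proof -
    have "ln 2 \<le> L * r" using ln_2_less_1 mult_mono[OF L r] L by simp
    then have "\<sigma>\<^sup>2 * m * ln 2 \<le> \<sigma>\<^sup>2 * m * (L * r)" using m by (intro mult_left_mono) auto
    then show ?thesis using V by (simp add: P_def m_def algebra_simps)
  qed
  moreover have "8 * (2 * \<sigma>\<^sup>2 * L) * W \<le> 32 * P"
  proof -
    have "W \<le> m * (1 + r)" unfolding m_def r_def by (rule W)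
    also have "\<dots> \<le> m * (2 * r)" using m r by (intro mult_left_mono) auto
    finally have "W \<le> m * (2 * r)" .
    then have "8 * (2 * \<sigma>\<^sup>2 * L) * W \<le> 8 * (2 * \<sigma>\<^sup>2 * L) * (m * (2 * r))"
      using L by (intro mult_left_mono) auto
    then show ?thesis by (simp add: P_def mult_ac)
  qed
  moreover have "0 \<le> 4 * \<sigma>\<^sup>2 * (real s + 1)" by simp
  ultimately have "2 * V + 8 * (2 * \<sigma>\<^sup>2 * L) * W + 4 * (real n * (2 * \<gamma>\<^sup>2 * \<sigma>\<^sup>2 * L)) * H
      \<le> 8 * l * \<sigma>\<^sup>2 + 4 * \<sigma>\<^sup>2 * (real s + 1) + 40 * P + 4 * (real n * (2 * \<gamma>\<^sup>2 * \<sigma>\<^sup>2 * L)) * H"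
    using P by linarith
  then have "(2 * V + 8 * (2 * \<sigma>\<^sup>2 * L) * W + 4 * (real n * (2 * \<gamma>\<^sup>2 * \<sigma>\<^sup>2 * L)) * H) / real n
      \<le> (8 * l * \<sigma>\<^sup>2 + 4 * \<sigma>\<^sup>2 * (real s + 1) + 40 * P + 4 * (real n * (2 * \<gamma>\<^sup>2 * \<sigma>\<^sup>2 * L)) * H) / real n"
    by (rule divide_right_mono) simp
  also have "\<dots> = 8 * l * \<sigma>\<^sup>2 / real n + 4 * \<sigma>\<^sup>2 * (real s + 1) / real n
      + 8 * \<sigma>\<^sup>2 * L * (2 * \<gamma>\<^sup>2 * (H / 2) + 5 * (m / real n) * r)"
    using n0 by (simp add: P_def field_simps)
  finally show ?thesis unfolding sq sq' r_def m_def by simp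
qed

theorem corollary6p1:
  fixes n s g :: nat
    and pa :: "nat \<Rightarrow> nat"
    and S R :: "nat set"
    and ps :: "nat list list"
    and M :: "'a measure"
    and f0 :: "nat \<Rightarrow> real"
    and \<epsilon> Y fhat :: "'a \<Rightarrow> nat \<Rightarrow> real"
    and \<sigma> \<delta> \<gamma> lam :: real
  assumes tree: "rooted_tree n pa"
    and S: "S \<subseteq> {2..n}" and s: "s = card S"
    and decomposition: "glued_paths n pa S R ps" and g: "g = length ps"
    and S_edges: "\<forall>p\<in>set ps. num_S_edges pa S p \<ge> 1"
    and segments: "\<forall>p\<in>set ps. \<forall>d\<in>set (segment_lengths pa S p). d \<ge> 4"
    and M: "prob_space M" and \<sigma>: "\<sigma> > 0"
    and f0: "f0 \<in> Rn n"
    and eps_rv: "\<epsilon> \<in> measurable M (\<Pi>\<^sub>M i\<in>{1..n}. borel)"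
    and eps_law: "distr M (\<Pi>\<^sub>M i\<in>{1..n}. borel) \<epsilon> = iso_normal n \<sigma>"
    and Y: "\<And>\<omega>. Y \<omega> = (\<lambda>i\<in>{1..n}. f0 i + \<epsilon> \<omega> i)"
    and \<delta>: "0 < \<delta>" "\<delta> < 1" and \<gamma>: "\<gamma> > 1"
    and lam: "lam = \<gamma> * \<sigma> * sqrt (2 * ln (4 * (real n - real s - 1) / \<delta>) / real n)"
    and fhat: "\<And>\<omega>. fhat \<omega> = tv_estimator n pa lam (Y \<omega>)"
  shows "measure M {\<omega> \<in> space M.
           sq_norm_n n (\<lambda>i. fhat \<omega> i - f0 i)
           \<le> (INF f\<in>Rn n. sq_norm_n n (\<lambda>i. f i - f0 i) + 4 * lam * l1_norm ({2..n} - S) (tree_diff pa f))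
             + 8 * ln (2 / \<delta>) * \<sigma>\<^sup>2 / real n
             + 4 * \<sigma>\<^sup>2 * (real s + 1) / real n
             + 8 * \<sigma>\<^sup>2 * ln (4 * (real n - real s - 1) / \<delta>)
               * (2 * \<gamma>\<^sup>2 * real s / harmonic_mean (Delta pa S ps)
                  + 5 * (real (s + g) / real n) * ln (real n / real (s + g)))}
         \<ge> 1 - \<delta>"
proof -
  interpret prob_space M by (rule M)
  define sg where "sg = tree_segments pa S ps"
  note facts = tree S decomposition
  define L where "L = ln (4 * (real n - real s - 1) / \<delta>)"
  define m where "m = real (s + g)"
  define H where "H = (\<Sum>x\<leftarrow>Delta pa S ps. 1 / x)"
  have long: "4 \<le> length q" if "q \<in> set sg" for q
    using that segments by (auto simp: sg_def tree_segments_def segment_lengths_def)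
  have len: "length sg = s + g"
    using length_segments[OF facts] by (simp add: sg_def s g)
  have g0: "0 < g" using decomposition by (auto simp: g glued_paths_def)
  have s0: "g \<le> s"
  proof -
    have "(\<Sum>p\<leftarrow>ps. 1) \<le> (\<Sum>p\<leftarrow>ps. num_S_edges pa S p)" using S_edges by (intro sum_list_mono) auto
    then show ?thesis using sum_num_S_edges[OF facts] by (simp add: s g sum_list_triv)
  qed
  have total: "(\<Sum>q\<leftarrow>sg. length q) = n"
    using sum_segments_vertices[OF facts, of "\<lambda>_. 1::nat"] by (simp add: sg_def)
  have n4: "4 * (s + g) \<le> n"
  proof -
    have "(\<Sum>q\<leftarrow>sg. 4) \<le> (\<Sum>q\<leftarrow>sg. length q)" using long by (intro sum_list_mono) auto
    then show ?thesis by (simp add: total sum_list_triv len)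
  qed
  then have n0: "0 < n" using g0 by simp
  have N: "1 \<le> real n - real s - 1" using of_nat_mono[OF n4, where 'a = real] g0 s0 by simp
  have L: "1 \<le> L"
  proof -
    have "exp 1 \<le> 4 * (real n - real s - 1)" using exp_le N by simp
    also have "\<dots> \<le> 4 * (real n - real s - 1) / \<delta>"
      using N \<delta> mult_left_le[of \<delta> "4 * (real n - real s - 1)"] by (simp add: pos_le_divide_eq)
    finally have "exp 1 \<le> 4 * (real n - real s - 1) / \<delta>" .
    then show ?thesis unfolding L_def using N \<delta> by (subst ln_ge_iff) auto
  qed
  have lam': "lam = \<gamma> * \<sigma> * sqrt (2 * L / real n)" by (simp add: lam L_def)
  have lam0: "0 \<le> lam" using \<gamma> \<sigma> L by (simp add: lam')
  \<comment> \<open>Up to probability \<open>\<delta> / 2\<close>, \<open>\<tau>\<close> bounds the bridge values relative to \<open>bridge_sd\<close>; \<open>lam\<close>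
    exceeds what this level requires by the factor \<open>\<gamma>\<close>.\<close>
  define \<tau> where "\<tau> = \<sigma> * sqrt (2 * L)"
  have \<tau>0: "0 \<le> \<tau>" using \<sigma> L by (simp add: \<tau>_def)
  have \<tau>le: "\<tau> * sqrt (real n) \<le> real n * lam"
  proof -
    have "real n * lam = \<gamma> * (\<tau> * sqrt (real n))"
    proof -
      have "real n * sqrt (2 * L / real n) = sqrt (2 * L) * (real n / sqrt (real n))"
        unfolding real_sqrt_divide by simp
      then show ?thesis unfolding lam' \<tau>_def by (simp add: real_div_sqrt)
    qed
    then show ?thesis using \<gamma> \<tau>0 mult_right_mono[of 1 \<gamma> "\<tau> * sqrt (real n)"] by simp
  qed
  have ind: "indep_vars (\<lambda>_. borel) (\<lambda>i \<omega>. \<epsilon> \<omega> i) {1..n}"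
    and dist: "\<And>i. i \<in> {1..n} \<Longrightarrow> distributed M lborel (\<lambda>\<omega>. \<epsilon> \<omega> i) (normal_density 0 \<sigma>)"
    using iso_normal_components[OF _ \<sigma> eps_rv eps_law] n0 by auto
  have "real (length q - 1) = real (length q) - 1" if "q \<in> set sg" for q
    using long[OF that] by (subst of_nat_diff) auto
  then have "(\<Sum>q\<leftarrow>sg. real (length q - 1)) = (\<Sum>q\<leftarrow>sg. real (length q) - 1)"
    by (intro arg_cong[of _ _ sum_list] map_cong) auto
  also have "\<dots> = real n - real (s + g)"
    unfolding sum_list_subtractf using sum_segments_vertices[OF facts, of "\<lambda>_. 1::real"] len
    by (simp add: sum_list_triv sg_def)
  finally have count: "(\<Sum>q\<leftarrow>sg. real (length q - 1)) \<le> real n - real s - 1" using g0 by simp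
  have segs: "distinct (concat sg)" "set (concat sg) \<subseteq> {1..n}" "[] \<notin> set sg"
    using distinct_segments[OF facts] set_segments[OF facts] segment_nonempty[OF facts]
    by (auto simp: sg_def)
  define tame where "tame \<omega> \<longleftrightarrow> (\<Sum>q\<leftarrow>sg. (\<Sum>i<length q. \<epsilon> \<omega> (q ! i))\<^sup>2 / real (length q))
        \<le> \<sigma>\<^sup>2 * (4 * ln (2 / \<delta>) + 2 * real (length sg) * ln 2) \<and>
      (\<forall>q\<in>set sg. \<forall>k. 0 < k \<longrightarrow> k < length q \<longrightarrow>
        \<bar>bridge (length q) (\<lambda>i. \<epsilon> \<omega> (q ! i)) k\<bar> \<le> \<tau> * bridge_sd (length q) k)" for \<omega>
  have "\<exists>G\<in>sets M. 1 - \<delta> \<le> measure M G \<and> (\<forall>\<omega>\<in>G. tame \<omega>)"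
    unfolding tame_def \<tau>_def L_def
    by (rule segment_noise_event[OF ind finite_atLeastAtMost dist \<sigma> segs \<delta> count N])
  then obtain G where G: "G \<in> sets M" "1 - \<delta> \<le> measure M G" and tame: "\<forall>\<omega>\<in>G. tame \<omega>"
    by blast
  have W: "(\<Sum>q\<leftarrow>sg. 1 + ln (real (length q))) \<le> m * (1 + ln (real n / m))"
  proof -
    have "0 < real (length sg)" using len g0 by simp
    from sum_ln_segment_lengths[OF facts this[unfolded sg_def] n0] show ?thesis
      unfolding m_def len[symmetric] sg_def .
  qed
  have hm: "real s / harmonic_mean (Delta pa S ps) = H / 2"
    using s0 g0 length_Delta[OF facts] S_edges by (simp add: harmonic_mean_def H_def s)
  define risk where "risk \<omega> = sq_norm_n n (\<lambda>i. fhat \<omega> i - f0 i)" for \<omega>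
  define bound where "bound f = sq_norm_n n (\<lambda>i. f i - f0 i)
      + 4 * lam * l1_norm ({2..n} - S) (tree_diff pa f)" for f
  define rest where "rest = 8 * ln (2 / \<delta>) * \<sigma>\<^sup>2 / real n + 4 * \<sigma>\<^sup>2 * (real s + 1) / real n
      + 8 * \<sigma>\<^sup>2 * L * (2 * \<gamma>\<^sup>2 * (H / 2) + 5 * (m / real n) * ln (real n / m))"
  have good: "risk \<omega> \<le> (INF f\<in>Rn n. bound f) + rest" if \<omega>: "\<omega> \<in> G" for \<omega>
  proof -
    define V where "V = (\<Sum>q\<leftarrow>sg. (\<Sum>i<length q. \<epsilon> \<omega> (q ! i))\<^sup>2 / real (length q))"
    have V: "V \<le> \<sigma>\<^sup>2 * (4 * ln (2 / \<delta>) + 2 * real (s + g) * ln 2)"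
      using tame \<omega> unfolding tame_def V_def len by blast
    have noise: "\<bar>bridge (length q) (\<lambda>i. \<epsilon> \<omega> (q ! i)) k\<bar> \<le> \<tau> * bridge_sd (length q) k"
      if "q \<in> set sg" "0 < k" "k < length q" for q k
      using tame \<omega> that unfolding tame_def by blast
    have "risk \<omega> - rest \<le> bound f" if f: "f \<in> Rn n" for f
    proof -
      have Y': "Y \<omega> i = f0 i + \<epsilon> \<omega> i" if "i \<in> {1..n}" for i
        using that by (simp add: Y)
      have long': "2 \<le> length q" if "q \<in> set sg" for q
        using long[OF that] by simp
      have "risk \<omega> \<le> bound f + (2 * V + 8 * \<tau>\<^sup>2 * (\<Sum>q\<leftarrow>sg. 1 + ln (real (length q)))
          + 4 * (real n * lam)\<^sup>2 * H) / real n"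
        unfolding risk_def bound_def fhat V_def H_def sg_def
        by (rule tv_estimator_oracle_inequality[OF facts S_edges long'[unfolded sg_def] \<tau>0 \<tau>le
              noise[unfolded sg_def] n0 lam0 f Y'])
      also have "(2 * V + 8 * \<tau>\<^sup>2 * (\<Sum>q\<leftarrow>sg. 1 + ln (real (length q)))
          + 4 * (real n * lam)\<^sup>2 * H) / real n \<le> rest"
        unfolding \<tau>_def lam' m_def rest_def
        by (rule remainder_bound[OF L n4 _ g0 _ V W[unfolded m_def]]) (use s0 g0 \<gamma> in auto)
      finally show ?thesis by simp
    qed
    moreover have "(\<lambda>i\<in>{1..n}. 0) \<in> Rn n" by (simp add: Rn_def)
    ultimately have "risk \<omega> - rest \<le> (INF f\<in>Rn n. bound f)" by (intro cINF_greatest) auto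
    then show ?thesis by simp
  qed
  have fhat_measurable: "(\<lambda>\<omega>. fhat \<omega> i) \<in> borel_measurable M" if "i \<in> {1..n}" for i
    unfolding fhat
  proof (rule tv_estimator_measurable[OF n0 lam0 that])
    fix j
    show "(\<lambda>\<omega>. Y \<omega> j) \<in> borel_measurable M"
    proof (cases "j \<in> {1..n}")
      case True
      then have "(\<lambda>\<omega>. \<epsilon> \<omega> j) \<in> borel_measurable M" using ind by (simp add: indep_vars_def)
      then show ?thesis using True by (simp add: Y)
    next
      case False
      then have "(\<lambda>\<omega>. Y \<omega> j) = (\<lambda>\<omega>. undefined)" by (intro ext) (auto simp: Y)
      then show ?thesis by simp
    qed
  qed
  have "risk \<in> borel_measurable M"
    unfolding risk_def[abs_def] sq_norm_n_def
    by (intro borel_measurable_divide borel_measurable_sum borel_measurable_power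
        borel_measurable_diff fhat_measurable borel_measurable_const)
  then have "{\<omega> \<in> space M. risk \<omega> \<le> (INF f\<in>Rn n. bound f) + rest} \<in> sets M" by measurable
  moreover have "G \<subseteq> {\<omega> \<in> space M. risk \<omega> \<le> (INF f\<in>Rn n. bound f) + rest}"
    using good sets.sets_into_space[OF G(1)] by blast
  ultimately have "1 - \<delta> \<le> measure M {\<omega> \<in> space M. risk \<omega> \<le> (INF f\<in>Rn n. bound f) + rest}"
    using order_trans[OF G(2) finite_measure_mono] by blast
  moreover have "2 * \<gamma>\<^sup>2 * real s / harmonic_mean (Delta pa S ps) = 2 * \<gamma>\<^sup>2 * (H / 2)"
    using hm by (metis times_divide_eq_right)
  ultimately show ?thesis
    by (simp only: risk_def bound_def rest_def L_def m_def add.assoc)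
qed

end
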